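(* Let $G$ be a group acting geometrically by simplicial automorphisms on a weakly systolic complex $\mathbf X$ (i.e. $G$ is a weakly systolic group). Then $G$ contains only finitely many conjugacy classes of finite subgroups.
   Context: All simplicial complexes are nonempty and flag (every set of vertices, each pair of which lies in a common simplex, is contained in a simplex) with connected $1$-skeleton. Distances, balls $B_r(v)$ and spheres $S_r(v)$ in $\mathbf X$ are those of its $1$-skeleton with the path metric. A flag complex $\mathbf X$ is weakly systolic if for every vertex $v$, every integer $i\ge 0$ and every nonempty simplex $\sigma$ with all vertices in $S_{i+1}(v)$, the set of vertices of $B_i(v)$ adjacent to all vertices of $\sigma$ spans a nonempty simplex. An action of a group on a locally finite simplicial complex $\mathbf X$ is properly discontinuous if stabilizers of simplices are finite, cocompact if the orbit space $G\backslash\mathbf X$ is compact, and geometric if it is both (so geometric actions are, by definition, on locally finite complexes). *)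

theory Defs
  imports "HOL-Analysis.Analysis" "HOL-Algebra.Group_Action"
begin

section \<open>Simplicial complexes\<close>

text \<open>A complex is given by its set of nonempty simplices, a simplex being its finite vertex set.\<close>

definition simplicial_complex :: "'v set set \<Rightarrow> bool" where
  "simplicial_complex X \<longleftrightarrow>
     (\<forall>\<sigma>\<in>X. finite \<sigma> \<and> \<sigma> \<noteq> {}) \<and> (\<forall>\<sigma>\<in>X. \<forall>\<tau>. \<tau> \<subseteq> \<sigma> \<and> \<tau> \<noteq> {} \<longrightarrow> \<tau> \<in> X)"

definition vertices :: "'v set set \<Rightarrow> 'v set" where
  "vertices X = \<Union>X"

definition flag :: "'v set set \<Rightarrow> bool" where
  "flag X \<longleftrightarrow>
     (\<forall>A \<subseteq> vertices X. (\<forall>u\<in>A. \<forall>v\<in>A. \<exists>\<sigma>\<in>X. u \<in> \<sigma> \<and> v \<in> \<sigma>) \<longrightarrow> (\<exists>\<sigma>\<in>X. A \<subseteq> \<sigma>))"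

definition locally_finite_complex :: "'v set set \<Rightarrow> bool" where
  "locally_finite_complex X \<longleftrightarrow> (\<forall>v\<in>vertices X. finite {\<sigma>\<in>X. v \<in> \<sigma>})"

definition adjacency :: "'v set set \<Rightarrow> ('v \<times> 'v) set" where
  "adjacency X = {(u, v). u \<noteq> v \<and> {u, v} \<in> X}"

definition connected_skeleton :: "'v set set \<Rightarrow> bool" where
  "connected_skeleton X \<longleftrightarrow> (\<forall>u\<in>vertices X. \<forall>v\<in>vertices X. (u, v) \<in> (adjacency X)\<^sup>*)"

text \<open>Path metric of the 1-skeleton; only meaningful if the two vertices are joined by a path.\<close>

definition graph_dist :: "'v set set \<Rightarrow> 'v \<Rightarrow> 'v \<Rightarrow> nat" where
  "graph_dist X u v = (LEAST n. (u, v) \<in> adjacency X ^^ n)"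

definition graph_ball :: "'v set set \<Rightarrow> nat \<Rightarrow> 'v \<Rightarrow> 'v set" where
  "graph_ball X r v = {w \<in> vertices X. graph_dist X v w \<le> r}"

definition graph_sphere :: "'v set set \<Rightarrow> nat \<Rightarrow> 'v \<Rightarrow> 'v set" where
  "graph_sphere X r v = {w \<in> vertices X. graph_dist X v w = r}"

definition weakly_systolic :: "'v set set \<Rightarrow> bool" where
  "weakly_systolic X \<longleftrightarrow>
     simplicial_complex X \<and> X \<noteq> {} \<and> flag X \<and> connected_skeleton X \<and>
     (\<forall>v\<in>vertices X. \<forall>i. \<forall>\<sigma>\<in>X. \<sigma> \<subseteq> graph_sphere X (i + 1) v \<longrightarrow>
        {w \<in> graph_ball X i v. \<forall>u\<in>\<sigma>. (w, u) \<in> adjacency X} \<in> X)"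


section \<open>Geometric realization\<close>

text \<open>Points are given by their barycentric coordinates.\<close>

definition realization :: "'v set set \<Rightarrow> ('v \<Rightarrow> real) set" where
  "realization X =
     {x. (\<forall>v. 0 \<le> x v) \<and> {v. x v \<noteq> 0} \<in> X \<and> (\<Sum>v | x v \<noteq> 0. x v) = 1}"

definition closed_face :: "'v set set \<Rightarrow> 'v set \<Rightarrow> ('v \<Rightarrow> real) set" where
  "closed_face X \<sigma> = {x \<in> realization X. {v. x v \<noteq> 0} \<subseteq> \<sigma>}"

text \<open>The weak topology determined by the closed faces. Functions carry the product topology
  of the library, which on a face, where only finitely many coordinates are nonzero, is the
  Euclidean one.\<close>

definition realization_topology :: "'v set set \<Rightarrow> ('v \<Rightarrow> real) topology" where
  "realization_topology X = topology (\<lambda>U. U \<subseteq> realization X \<and>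
     (\<forall>\<sigma>\<in>X. openin (top_of_set (closed_face X \<sigma>)) (U \<inter> closed_face X \<sigma>)))"

lemma istopology_realization:
  "istopology (\<lambda>U. U \<subseteq> realization X \<and>
     (\<forall>\<sigma>\<in>X. openin (top_of_set (closed_face X \<sigma>)) (U \<inter> closed_face X \<sigma>)))"
proof -
  let ?L = "\<lambda>U. U \<subseteq> realization X \<and>
     (\<forall>\<sigma>\<in>X. openin (top_of_set (closed_face X \<sigma>)) (U \<inter> closed_face X \<sigma>))"
  have "?L (S \<inter> T)" if "?L S" "?L T" for S T
  proof -
    have "S \<inter> T \<inter> C = (S \<inter> C) \<inter> (T \<inter> C)" for C
      by blast
    then show ?thesis
      using that openin_Int by (metis le_infI1)
  qed
  moreover have "?L (\<Union>\<K>)" if K: "\<forall>K\<in>\<K>. ?L K" for \<K>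
  proof -
    have "openin (top_of_set C) (\<Union>\<K> \<inter> C)"
      if "\<And>K. K \<in> \<K> \<Longrightarrow> openin (top_of_set C) (K \<inter> C)" for C
    proof -
      have "\<Union>\<K> \<inter> C = \<Union>((\<lambda>K. K \<inter> C) ` \<K>)"
        by blast
      then show ?thesis
        using that by (metis (no_types, lifting) imageE openin_Union)
    qed
    then show ?thesis
      using K by blast
  qed
  ultimately show ?thesis
    unfolding istopology_def by blast
qed

lemma openin_realization_topology:
  "openin (realization_topology X) U \<longleftrightarrow> U \<subseteq> realization X \<and>
     (\<forall>\<sigma>\<in>X. openin (top_of_set (closed_face X \<sigma>)) (U \<inter> closed_face X \<sigma>))"
  unfolding realization_topology_def topology_inverse'[OF istopology_realization] ..

lemma topspace_realization_topology: "topspace (realization_topology X) = realization X"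
proof (rule antisym)
  show "topspace (realization_topology X) \<subseteq> realization X"
    using openin_realization_topology openin_topspace by blast
  have "realization X \<inter> closed_face X \<sigma> = closed_face X \<sigma>" for \<sigma>
    by (auto simp: closed_face_def)
  then show "realization X \<subseteq> topspace (realization_topology X)"
    by (intro openin_subset) (simp add: openin_realization_topology)
qed


section \<open>Group actions on complexes\<close>

definition simplicial_action ::
    "('g, 'b) monoid_scheme \<Rightarrow> 'v set set \<Rightarrow> ('g \<Rightarrow> 'v \<Rightarrow> 'v) \<Rightarrow> bool" where
  "simplicial_action G X \<phi> \<longleftrightarrow>
     group_action G (vertices X) \<phi> \<and> (\<forall>g\<in>carrier G. \<forall>\<sigma>\<in>X. \<phi> g ` \<sigma> \<in> X)"

text \<open>The affine extension of the action to the realization: the coordinate of \<open>g x\<close> at \<open>g v\<close>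
  is that of \<open>x\<close> at \<open>v\<close>.\<close>

definition realization_action ::
    "('g, 'b) monoid_scheme \<Rightarrow> 'v set set \<Rightarrow> ('g \<Rightarrow> 'v \<Rightarrow> 'v) \<Rightarrow> 'g \<Rightarrow> ('v \<Rightarrow> real) \<Rightarrow> 'v \<Rightarrow> real" where
  "realization_action G X \<phi> g x = (\<lambda>v. if v \<in> vertices X then x (\<phi> (inv\<^bsub>G\<^esub> g) v) else 0)"

lemma realization_action_apply:
  assumes "group_action G (vertices X) \<phi>" "g \<in> carrier G" "v \<in> vertices X"
  shows "realization_action G X \<phi> g x (\<phi> g v) = x v"
  using assms group_action.orbit_sym_aux[OF assms(1,2,3)] group_action.element_image[OF assms]
  by (simp add: realization_action_def)

text \<open>The set of orbits with the quotient topology.\<close>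

definition orbit_space ::
    "('g, 'b) monoid_scheme \<Rightarrow> 'v set set \<Rightarrow> ('g \<Rightarrow> 'v \<Rightarrow> 'v) \<Rightarrow> ('v \<Rightarrow> real) set topology" where
  "orbit_space G X \<phi> = topology (\<lambda>U.
     U \<subseteq> orbits G (realization X) (realization_action G X \<phi>) \<and>
     openin (realization_topology X)
       {x \<in> realization X. orbit G (realization_action G X \<phi>) x \<in> U})"

lemma istopology_orbit_space:
  "istopology (\<lambda>U. U \<subseteq> orbits G (realization X) a \<and>
     openin (realization_topology X) {x \<in> realization X. orbit G a x \<in> U})"
proof -
  let ?P = "\<lambda>U. {x \<in> realization X. orbit G a x \<in> U}"
  have "?P (S \<inter> T) = ?P S \<inter> ?P T" for S T
    by blast
  moreover have "?P (\<Union>\<K>) = \<Union>(?P ` \<K>)" for \<K>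
    by blast
  ultimately show ?thesis
    unfolding istopology_def
    by (auto simp del: Int_iff Union_iff simp: openin_Int Sup_le_iff le_infI1 intro!: openin_Union)
qed

lemma openin_orbit_space:
  "openin (orbit_space G X \<phi>) U \<longleftrightarrow>
     U \<subseteq> orbits G (realization X) (realization_action G X \<phi>) \<and>
     openin (realization_topology X)
       {x \<in> realization X. orbit G (realization_action G X \<phi>) x \<in> U}"
  unfolding orbit_space_def topology_inverse'[OF istopology_orbit_space] ..

lemma topspace_orbit_space:
  "topspace (orbit_space G X \<phi>) = orbits G (realization X) (realization_action G X \<phi>)"
proof (rule antisym)
  show "topspace (orbit_space G X \<phi>) \<subseteq> orbits G (realization X) (realization_action G X \<phi>)"
    using openin_orbit_space openin_topspace by blast
  have "{x \<in> realization X. orbit G (realization_action G X \<phi>) x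
      \<in> orbits G (realization X) (realization_action G X \<phi>)} = topspace (realization_topology X)"
    by (auto simp: orbits_def topspace_realization_topology)
  then show "orbits G (realization X) (realization_action G X \<phi>) \<subseteq> topspace (orbit_space G X \<phi>)"
    by (intro openin_subset) (simp add: openin_orbit_space)
qed

lemma quotient_map_orbit_space:
  "quotient_map (realization_topology X) (orbit_space G X \<phi>)
     (orbit G (realization_action G X \<phi>))"
  unfolding quotient_map_def topspace_orbit_space topspace_realization_topology openin_orbit_space
  by (auto simp: orbits_def)

text \<open>Stabilizers of simplices are setwise.\<close>

definition properly_discontinuous ::
    "('g, 'b) monoid_scheme \<Rightarrow> 'v set set \<Rightarrow> ('g \<Rightarrow> 'v \<Rightarrow> 'v) \<Rightarrow> bool" where
  "properly_discontinuous G X \<phi> \<longleftrightarrow> (\<forall>\<sigma>\<in>X. finite (stabilizer G (\<lambda>g \<tau>. \<phi> g ` \<tau>) \<sigma>))"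

definition cocompact ::
    "('g, 'b) monoid_scheme \<Rightarrow> 'v set set \<Rightarrow> ('g \<Rightarrow> 'v \<Rightarrow> 'v) \<Rightarrow> bool" where
  "cocompact G X \<phi> \<longleftrightarrow> compact_space (orbit_space G X \<phi>)"

definition geometric_action ::
    "('g, 'b) monoid_scheme \<Rightarrow> 'v set set \<Rightarrow> ('g \<Rightarrow> 'v \<Rightarrow> 'v) \<Rightarrow> bool" where
  "geometric_action G X \<phi> \<longleftrightarrow>
     simplicial_action G X \<phi> \<and> locally_finite_complex X \<and>
     properly_discontinuous G X \<phi> \<and> cocompact G X \<phi>"


section \<open>Conjugacy classes of finite subgroups\<close>

definition finite_subgroup_classes :: "('g, 'b) monoid_scheme \<Rightarrow> 'g set set set" where
  "finite_subgroup_classes G =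
     orbits G {H. subgroup H G \<and> finite H} (\<lambda>g H. g <#\<^bsub>G\<^esub> H #>\<^bsub>G\<^esub> inv\<^bsub>G\<^esub> g)"

end

theory Submission
  imports Defs
begin

text \<open>
  A finite subgroup \<open>H\<close> stabilizes a simplex: the balls of a weakly systolic complex are geodesically
  convex, so the intersection of the balls of a large common radius around the points of an
  \<open>H\<close>-orbit is a finite, convex, \<open>H\<close>-invariant set \<open>C\<close>, again weakly systolic in the induced metric.
  Passing to the vertices with maximal closed neighbourhood preserves invariance and weak
  systolicity, so one reaches a set in which every domination is between vertices with equal closed
  neighbourhoods. Picking one vertex from each class of twins leaves a finite weakly systolic graph
  without dominated vertices. But in a finite weakly systolic graph with at least two vertices the
  last vertex of a lexicographic breadth-first search is dominated by its father; so there is just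
  one class of twins, a clique, and hence by flagness an invariant simplex.

  By cocompactness there are finitely many orbits of vertices (the orbits of open stars of vertices
  form an open cover of the quotient). Hence, up to conjugacy, the simplex stabilized by \<open>H\<close> is one
  of the finitely many simplices that contain one of finitely many vertices, and \<open>H\<close> is a subset of
  its finite stabilizer.
\<close>

section \<open>Weakly bridged metrics\<close>

text \<open>Weak systolicity in terms of the metric alone, using only projections of vertices and edges.
  Convex subsets and subsets obtained by removing dominated vertices inherit it with the same \<open>d\<close>.\<close>

locale weakly_bridged =
  fixes V :: "'a set" and d :: "'a \<Rightarrow> 'a \<Rightarrow> nat"
  assumes dist_eq_0: "x \<in> V \<Longrightarrow> y \<in> V \<Longrightarrow> d x y = 0 \<longleftrightarrow> x = y"
    and dist_sym: "x \<in> V \<Longrightarrow> y \<in> V \<Longrightarrow> d x y = d y x"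
    and dist_triangle: "x \<in> V \<Longrightarrow> y \<in> V \<Longrightarrow> z \<in> V \<Longrightarrow> d x z \<le> d x y + d y z"
    and geodesic: "x \<in> V \<Longrightarrow> y \<in> V \<Longrightarrow> d x y = Suc n \<Longrightarrow> \<exists>z\<in>V. d x z = n \<and> d z y = 1"
    and proj_clique: "\<lbrakk>v \<in> V; x \<in> V; y \<in> V; z \<in> V; d v x = Suc n; d v y \<le> n; d v z \<le> n;
        d y x = 1; d z x = 1\<rbrakk> \<Longrightarrow> d y z \<le> 1"
    and proj_edge: "\<lbrakk>v \<in> V; x \<in> V; y \<in> V; d v x = Suc n; d v y = Suc n; d x y = 1\<rbrakk>
        \<Longrightarrow> \<exists>z\<in>V. d v z = n \<and> d z x = 1 \<and> d z y = 1"
begin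

lemma dist_self: "x \<in> V \<Longrightarrow> d x x = 0"
  by (simp add: dist_eq_0)

text \<open>Seen from \<open>a\<close>, the opposite corner \<open>c\<close> lies at distance 2, so
  \<open>b\<close> and \<open>e\<close> are both projections of \<open>c\<close> and hence equal or
  adjacent.\<close>

lemma no_induced_square:
  assumes V: "a \<in> V" "b \<in> V" "c \<in> V" "e \<in> V"
    and E: "d a b = 1" "d b c = 1" "d c e = 1" "d e a = 1" and "\<not> d a c \<le> 1"
  shows "d b e \<le> 1"
proof -
  have "d a c = Suc 1"
    using dist_triangle[of a b c] assms by simp
  then show ?thesis
    using proj_clique[of a c b e 1] V E dist_sym[of c e] dist_sym[of e a] by simp
qed

text \<open>This is the geodesic convexity of balls. By induction on \<open>d x y\<close> it
  suffices to exclude that the distance to \<open>u\<close> exceeds the bound at the first step from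
  \<open>x\<close>; such a step would produce a shorter interval on which the bound fails.\<close>

lemma interval_level_le:
  assumes "u \<in> V" "x \<in> V" "y \<in> V" "z \<in> V" "d x z + d z y = d x y"
  shows "d u z \<le> max (d u x) (d u y)"
  using assms(2-)
proof (induction "d x y" arbitrary: x y z rule: less_induct)
  case less
  note V = \<open>u \<in> V\<close> \<open>x \<in> V\<close> \<open>y \<in> V\<close> \<open>z \<in> V\<close>
  show ?case
  proof (cases "x = z \<or> y = z")
    case False
    then have zx: "d z x \<noteq> 0" "d z y \<noteq> 0" "d z x = d x z"
      using V dist_eq_0 dist_sym by auto
    then obtain m where m: "d z x = Suc m"
      by (metis not0_implies_Suc)
    then obtain x1 where x1: "x1 \<in> V" "d z x1 = m" "d x1 x = 1"
      using geodesic V by blast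
    have x1s: "d x1 z = m" "d x x1 = 1"
      using x1 V dist_sym by auto
    have x1y: "Suc (d x1 y) = d x y"
      using dist_triangle[of x x1 y] dist_triangle[of x1 z y] x1 x1s V less.prems m zx by simp
    have lx1: "d u x1 \<le> Suc (d u x)"
      using dist_triangle[of u x x1] x1 x1s V by simp
    show ?thesis
    proof (cases "d u x1 \<le> max (d u x) (d u y)")
      case True
      then show ?thesis
        using less.hyps[of x1 y z] x1 x1s x1y V less.prems zx m by fastforce
    next
      case False
      then have lx: "d u x1 = Suc (d u x)" and ly: "d u y \<le> d u x"
        using lx1 by auto
      have "d x1 y \<noteq> 0"
        using False x1 V dist_eq_0 by auto
      then obtain j where j: "d y x1 = Suc j"
        using x1 V dist_sym by (metis not0_implies_Suc)
      then obtain x2 where x2: "x2 \<in> V" "d y x2 = j" "d x2 x1 = 1"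
        using geodesic V x1 by blast
      have x2s: "d x2 y = j" "d x1 x2 = 1" "d x1 y = Suc j"
        using x2 x1 V j dist_sym by auto
      have "\<not> d x x2 \<le> 1"
        using dist_triangle[of x x2 y] x2 x2s x1y V by auto
      moreover have "d x x2 \<le> 2"
        using dist_triangle[of x x1 x2] x2 x2s x1 x1s V by auto
      ultimately have xx2: "d x x2 = 2"
        by auto
      \<comment> \<open>Otherwise \<open>x\<close> and \<open>x2\<close> are two projections of
        \<open>x1\<close> towards \<open>u\<close>, yet they are at distance 2.\<close>
      have nyx: "\<not> d u x2 \<le> d u x"
        using proj_clique[of u x1 x x2 "d u x"] V x1 x1s x2 lx xx2 by auto
      have "j \<noteq> 0"
        using nyx ly x2 V dist_eq_0 by auto
      then have "d u x2 \<le> Suc (d u x)"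
        using less.hyps[of x1 y x2] x1 x2 x2s x1y V lx ly by fastforce
      then have lx2: "d u x2 = Suc (d u x)"
        using nyx by simp
      \<comment> \<open>\<open>w\<close> takes the place of \<open>x\<close>: it lies on the level
        of \<open>x\<close> but is one step closer to \<open>y\<close>, so the induction hypothesis
        for \<open>w\<close>, \<open>y\<close> and \<open>x2\<close> contradicts
        \<open>lx2\<close>.\<close>
      obtain w where w: "w \<in> V" "d u w = d u x" "d w x1 = 1" "d w x2 = 1"
        using proj_edge[of u x1 x2] V x1 x2 x2s lx lx2 by blast
      have "d x w \<le> 1"
        using proj_clique[of u x1 x w "d u x"] V x1 x1s w lx by simp
      then have wy: "d w y = Suc j"
        using dist_triangle[of x w y] dist_triangle[of w x2 y] w x1y x2s x2 V by auto
      then show ?thesis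
        using less.hyps[of w y x2] w x2 x2s x1y V lx2 ly by simp
    qed
  qed auto
qed

section \<open>Subsets that inherit weak bridgedness\<close>

lemma subset_of_projections:
  assumes "C \<subseteq> V"
    and "\<And>x y n. \<lbrakk>x \<in> C; y \<in> C; d x y = Suc n\<rbrakk> \<Longrightarrow> \<exists>z\<in>C. d x z = n \<and> d z y = 1"
    and "\<And>v x y n. \<lbrakk>v \<in> C; x \<in> C; y \<in> C; d v x = Suc n; d v y = Suc n; d x y = 1\<rbrakk>
      \<Longrightarrow> \<exists>z\<in>C. d v z = n \<and> d z x = 1 \<and> d z y = 1"
  shows "weakly_bridged C d"
proof
  fix x y assume "x \<in> C" "y \<in> C"
  then have "x \<in> V" "y \<in> V"
    using \<open>C \<subseteq> V\<close> by auto
  then show "d x y = 0 \<longleftrightarrow> x = y" "d x y = d y x"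
    by (rule dist_eq_0, rule dist_sym)
next
  fix x y z assume "x \<in> C" "y \<in> C" "z \<in> C"
  then show "d x z \<le> d x y + d y z"
    using \<open>C \<subseteq> V\<close> dist_triangle[of x y z] by auto
next
  fix v x y z n
  assume "v \<in> C" "x \<in> C" "y \<in> C" "z \<in> C" "d v x = Suc n" "d v y \<le> n" "d v z \<le> n"
    "d y x = 1" "d z x = 1"
  then show "d y z \<le> 1"
    using \<open>C \<subseteq> V\<close> proj_clique[of v x y z n] by auto
qed (fact assms)+

text \<open>Projections lie on geodesics from the base point, so a geodesically convex set contains
  those of its vertices and edges.\<close>

lemma convex_subset:
  assumes "C \<subseteq> V"
    and conv: "\<And>x y z. \<lbrakk>x \<in> C; y \<in> C; z \<in> V; d x z + d z y = d x y\<rbrakk> \<Longrightarrow> z \<in> C"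
  shows "weakly_bridged C d"
proof (rule subset_of_projections)
  fix x y n assume xy: "x \<in> C" "y \<in> C" "d x y = Suc n"
  then obtain z where "z \<in> V" "d x z = n" "d z y = 1"
    using geodesic \<open>C \<subseteq> V\<close> by blast
  then show "\<exists>z\<in>C. d x z = n \<and> d z y = 1"
    using conv[of x y z] xy by auto
next
  fix v x y n assume xy: "v \<in> C" "x \<in> C" "y \<in> C" "d v x = Suc n" "d v y = Suc n" "d x y = 1"
  then obtain z where "z \<in> V" "d v z = n" "d z x = 1" "d z y = 1"
    using proj_edge \<open>C \<subseteq> V\<close> by blast
  then show "\<exists>z\<in>C. d v z = n \<and> d z x = 1 \<and> d z y = 1"
    using conv[of v x z] xy by auto
qed (fact \<open>C \<subseteq> V\<close>)

text \<open>The last vertex before \<open>z\<close> on a geodesic from \<open>v\<close> lies in the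
  closed neighbourhood of \<open>z\<close>, hence in that of \<open>r\<close>.\<close>

lemma dominating_dist_le:
  assumes V: "v \<in> V" "z \<in> V" "r \<in> V" and "v \<noteq> z"
    and dom: "\<And>y. y \<in> V \<Longrightarrow> d y z \<le> 1 \<Longrightarrow> d y r \<le> 1"
  shows "d v r \<le> d v z"
proof -
  obtain n where n: "d v z = Suc n"
    using V \<open>v \<noteq> z\<close> dist_eq_0 by (metis not0_implies_Suc)
  then obtain y where "y \<in> V" "d v y = n" "d y z = 1"
    using geodesic V by blast
  then show ?thesis
    using dom[of y] dist_triangle[of v y r] V n by simp
qed

text \<open>A projection \<open>z\<close> may be replaced by a vertex \<open>r\<close> of
  \<open>R\<close> dominating it: \<open>r\<close> is no farther from the base point and keeps the
  required neighbours. If \<open>z\<close> is the base point itself, it already lies in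
  \<open>R\<close>.\<close>

lemma dominating_subset:
  assumes "R \<subseteq> V"
    and dom: "\<And>z. z \<in> V \<Longrightarrow> \<exists>r\<in>R. \<forall>y\<in>V. d y z \<le> 1 \<longrightarrow> d y r \<le> 1"
  shows "weakly_bridged R d"
proof (rule subset_of_projections)
  fix x y n assume xy: "x \<in> R" "y \<in> R" "d x y = Suc n"
  then obtain z where z: "z \<in> V" "d x z = n" "d z y = 1"
    using geodesic \<open>R \<subseteq> V\<close> by blast
  obtain r where r: "r \<in> R" "\<And>y. y \<in> V \<Longrightarrow> d y z \<le> 1 \<Longrightarrow> d y r \<le> 1"
    using dom[OF z(1)] by blast
  have V: "x \<in> V" "y \<in> V" "r \<in> V"
    using xy r \<open>R \<subseteq> V\<close> by auto
  show "\<exists>z\<in>R. d x z = n \<and> d z y = 1"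
  proof (cases "x = z")
    case True
    then show ?thesis
      using z xy by blast
  next
    case False
    then have "d x r \<le> n" "d y r \<le> 1"
      using dominating_dist_le[of x z r] r z V dist_sym[of y z] by auto
    then have "d x r = n \<and> d r y = 1"
      using dist_triangle[of x r y] V xy dist_sym[of r y] by auto
    then show ?thesis
      using r by blast
  qed
next
  fix v x y n assume xy: "v \<in> R" "x \<in> R" "y \<in> R" "d v x = Suc n" "d v y = Suc n" "d x y = 1"
  then obtain z where z: "z \<in> V" "d v z = n" "d z x = 1" "d z y = 1"
    using proj_edge \<open>R \<subseteq> V\<close> by blast
  obtain r where r: "r \<in> R" "\<And>y. y \<in> V \<Longrightarrow> d y z \<le> 1 \<Longrightarrow> d y r \<le> 1"
    using dom[OF z(1)] by blast
  have V: "v \<in> V" "x \<in> V" "y \<in> V" "r \<in> V"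
    using xy r \<open>R \<subseteq> V\<close> by auto
  show "\<exists>z\<in>R. d v z = n \<and> d z x = 1 \<and> d z y = 1"
  proof (cases "v = z")
    case True
    then show ?thesis
      using z xy by blast
  next
    case False
    then have "d v r \<le> n" "d x r \<le> 1" "d y r \<le> 1"
      using dominating_dist_le[of v z r] r z V dist_sym[of y z] dist_sym[of x z] by auto
    then have "d v r = n \<and> d r x = 1 \<and> d r y = 1"
      using dist_triangle[of v r y] dist_triangle[of v r x] V xy dist_sym[of r y] dist_sym[of r x]
      by auto
    then show ?thesis
      using r by blast
  qed
qed (fact \<open>R \<subseteq> V\<close>)

end

section \<open>Lexicographic breadth-first search\<close>

text \<open>The vertices are named by their position in the search order; the base point is \<open>0\<close>.\<close>

locale lex_bfs = weakly_bridged "{..<N}" D for N :: nat and D +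
  assumes lex: "\<lbrakk>i < j; j < N; l < i; D l j = 1; D l i \<noteq> 1\<rbrakk>
    \<Longrightarrow> \<exists>m<l. D m i = 1 \<and> D m j \<noteq> 1"
begin

text \<open>The least neighbour overall; by \<open>earlier_neighbour\<close> it precedes
  \<open>u\<close> as soon as \<open>u\<close> is not the base point.\<close>

definition father :: "nat \<Rightarrow> nat" where
  "father u = (LEAST j. j < N \<and> D j u = 1)"

lemma earlier_neighbour:
  assumes "0 < u" "u < N"
  shows "\<exists>j<u. D j u = 1"
proof -
  \<comment> \<open>Among the vertices not before \<open>u\<close> take one closest to the base
    point: its predecessor on a geodesic must precede \<open>u\<close>, and then the order forces
    \<open>u\<close> to have an earlier neighbour as well.\<close>
  obtain w where w: "u \<le> w" "w < N" and min: "\<And>z. \<lbrakk>u \<le> z; z < N\<rbrakk> \<Longrightarrow> D 0 w \<le> D 0 z"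
    using ex_has_least_nat[of "\<lambda>w. u \<le> w \<and> w < N" u "D 0"] assms by auto
  have "D 0 w \<noteq> 0"
    using dist_eq_0[of 0 w] w assms by auto
  then obtain k where k: "D 0 w = Suc k"
    by (metis not0_implies_Suc)
  then obtain z where z: "z < N" "D 0 z = k" "D z w = 1"
    using geodesic[of 0 w] w assms by auto
  have zu: "z < u"
    using min[of z] k z by (cases "u \<le> z") auto
  show ?thesis
  proof (cases "u = w")
    case False
    then show ?thesis
      using lex[of u w z] zu z w by (metis le_neq_implies_less less_trans)
  qed (use zu z in blast)
qed

lemma father:
  assumes "0 < u" "u < N"
  shows "father u < u" "father u < N" "D (father u) u = 1" "D u (father u) = 1"
proof -
  obtain j where j: "j < u" "D j u = 1"
    using earlier_neighbour[OF assms] by blast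
  have *: "father u < N \<and> D (father u) u = 1"
    unfolding father_def by (rule LeastI[of _ j]) (use j assms in auto)
  have "father u \<le> j"
    unfolding father_def by (rule Least_le) (use j assms in auto)
  then show "father u < u" "father u < N" "D (father u) u = 1" "D u (father u) = 1"
    using * j dist_sym[of u "father u"] assms by auto
qed

lemma father_le: "\<lbrakk>j < N; D j u = 1\<rbrakk> \<Longrightarrow> father u \<le> j"
  unfolding father_def by (rule Least_le) auto

text \<open>If \<open>father w\<close> came before \<open>father u\<close>, it would not be adjacent
  to \<open>u\<close>, and the search order would give \<open>u\<close> an even earlier
  neighbour.\<close>

lemma father_mono:
  assumes "0 < u" "u < w" "w < N"
  shows "father u \<le> father w"
proof (rule ccontr)
  assume *: "\<not> father u \<le> father w"
  have w: "father w < N" "D (father w) w = 1"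
    using father assms by auto
  have u: "father u < u"
    using father assms by auto
  have "D (father w) u \<noteq> 1"
    using * father_le w by blast
  then obtain m where "m < father w" "D m u = 1"
    using lex[of u w "father w"] u * w assms by auto
  then show False
    using father_le[of m u] * w by linarith
qed

text \<open>By monotonicity of fathers, \<open>father u\<close> does not come after a vertex one
  level below \<open>w\<close>, so induction applies to it. Thus the spheres around the base point
  are searched in turn.\<close>

lemma level_mono:
  assumes "u \<le> w" "w < N"
  shows "D 0 u \<le> D 0 w"
  using assms
proof (induction "D 0 w" arbitrary: u w)
  case 0
  then show ?case
    using dist_eq_0[of 0 w] by auto
next
  case (Suc n)
  then obtain x where x: "x < N" "D 0 x = n" "D x w = 1"
    using geodesic[of 0 w n] by auto
  show ?case
  proof (cases "u = 0 \<or> u = w")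
    case True
    then show ?thesis
      using dist_self[of 0] Suc.prems by auto
  next
    case False
    then have "father u \<le> x"
      using father_le[of x w] father_mono[of u w] x Suc.prems by auto
    then have "D 0 (father u) \<le> n"
      using Suc.hyps(1)[of x "father u"] x by auto
    then show ?thesis
      using dist_triangle[of 0 "father u" u] father[of u] False Suc.prems Suc.hyps(2) by auto
  qed
qed

lemma level_father:
  assumes "u < N" "D 0 u = Suc k"
  shows "D 0 (father u) = k"
proof -
  have "0 < u"
    using assms dist_self[of 0] by (cases u) auto
  obtain x where x: "x < N" "D 0 x = k" "D x u = 1"
    using geodesic[of 0 u k] assms by auto
  then have "D 0 (father u) \<le> k"
    using level_mono father_le by auto
  then show ?thesis
    using dist_triangle[of 0 "father u" u] father[of u] \<open>0 < u\<close> assms by auto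
qed

text \<open>By induction over \<open>u\<close> and, for fixed \<open>u\<close>, over
  \<open>w\<close>. A failure puts \<open>w\<close> and \<open>u\<close> on the same level with
  distinct, non-adjacent fathers, and the search order then leads to a contradiction.\<close>

theorem father_dominates:
  assumes "w < u" "u < N" "D w u = 1"
  shows "D (father u) w \<le> 1"
  using assms
proof (induction u arbitrary: w rule: less_induct)
  case (less u)
  note IHu = less.IH
  show ?case
    using less.prems
  proof (induction w rule: less_induct)
    case (less w)
    note IHw = less.IH
    have lt: "w < u" "u < N" "w < N" and wu: "D w u = 1" "D u w = 1"
      using less.prems dist_sym[of w u] by auto
    define fu where "fu = father u"
    define fw where "fw = father w"
    have fu: "fu < u" "fu < N" "D fu u = 1" "D u fu = 1" and fu_min: "\<And>j. \<lbrakk>j < N; D j u = 1\<rbrakk> \<Longrightarrow> fu \<le> j"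
      using father[of u] father_le lt by (auto simp: fu_def)
    have lev_le: "D 0 w \<le> D 0 u"
      using level_mono lt by simp
    have "D 0 u \<noteq> 0"
      using dist_eq_0[of 0 u] lt by auto
    then obtain k where lu: "D 0 u = Suc k"
      by (metis not0_implies_Suc)
    have lfu: "D 0 fu = k"
      using level_father lu lt fu_def by simp
    show ?case
    proof (rule ccontr)
      assume "\<not> D (father u) w \<le> 1"
      then have fu_w: "\<not> D fu w \<le> 1"
        by (simp add: fu_def)
      \<comment> \<open>Otherwise \<open>fu\<close> and \<open>w\<close> are both projections of
        \<open>u\<close> towards the base point.\<close>
      have "\<not> D 0 w \<le> k"
        using proj_clique[of 0 u fu w k] lt fu lu lfu wu fu_w by auto
      then have lw: "D 0 w = Suc k"
        using lev_le lu by simp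
      then have "0 < w"
        using dist_self[of 0] lt by (cases w) auto
      then have fw: "fw < w" "fw < N" "D fw w = 1" "D w fw = 1"
        and fw_min: "\<And>j. \<lbrakk>j < N; D j w = 1\<rbrakk> \<Longrightarrow> fw \<le> j"
        using father[of w] father_le lt by (auto simp: fw_def)
      have lfw: "D 0 fw = k"
        using level_father lw lt fw_def by simp
      have "fw \<noteq> fu"
        using fu_w fw by auto
      then have fwu: "fw < fu"
        using father_mono[of w u] \<open>0 < w\<close> lt by (simp add: fu_def fw_def)
      then have fw_u: "\<not> D fw u \<le> 1"
        using fu_min[of fw] dist_eq_0[of fw u] fw fu lt by (auto simp: le_Suc_eq)
      have fufw: "\<not> D fu fw \<le> 1"
      proof
        assume *: "D fu fw \<le> 1"
        then have "D fu fw = 1"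
          using dist_eq_0[of fu fw] fu fw \<open>fw \<noteq> fu\<close> by (auto simp: le_Suc_eq)
        then show False
          using no_induced_square[of fu fw w u] fu_w fw_u wu fu fw lt by auto
      qed
      \<comment> \<open>Let \<open>s\<close> be the first common lower neighbour of \<open>w\<close> and \<open>u\<close>; comparing the search order
        of \<open>fu\<close> with \<open>s\<close>, and then that of \<open>fw\<close> with \<open>fu\<close>, gives \<open>g < b < fw < fu < s\<close>. Projecting
        from \<open>g\<close> as base point produces a common neighbour \<open>t\<close> of \<open>g\<close> and \<open>u\<close>, which should have been
        visited before \<open>s\<close> because of \<open>g\<close>.\<close>
      define common where "common s \<longleftrightarrow> s < N \<and> D 0 s = k \<and> D s w = 1 \<and> D s u = 1" for s
      define s where "s = (LEAST s. common s)"
      have "\<exists>s. common s"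
        using proj_edge[of 0 w u k] lw lu wu lt unfolding common_def by auto
      then have "common s"
        unfolding s_def by (rule LeastI_ex)
      have s_min: "s \<le> t" if "common t" for t
        unfolding s_def using that by (rule Least_le)
      have s: "s < N" "D 0 s = k" "D s w = 1" "D s u = 1" "D w s = 1" "D u s = 1"
        using \<open>common s\<close> dist_sym[of s w] dist_sym[of s u] lt by (auto simp: common_def)
      have "s \<noteq> fu" "s \<noteq> fw"
        using s fu_w fw_u by auto
      then have fus: "fu < s" and fws: "fw < s"
        using fu_min[of s] fw_min[of s] s by auto
      have su: "s < u"
        using level_mono[of u s] s lu by (cases "u \<le> s") auto
      have E_fus: "D fu s = 1" "D s fu = 1"
        using proj_clique[of 0 u fu s k] dist_eq_0[of fu s] dist_sym[of fu s] lt fu s lu lfu \<open>s \<noteq> fu\<close>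
        by (auto simp: le_Suc_eq)
      have E_fws: "D fw s = 1" "D s fw = 1"
        using proj_clique[of 0 w fw s k] dist_eq_0[of fw s] dist_sym[of fw s] lt fw s lw lfw \<open>s \<noteq> fw\<close>
        by (auto simp: le_Suc_eq)
      define b where "b = (LEAST b. D b fu = 1 \<and> D b s \<noteq> 1)"
      obtain b0 where b0: "b0 < fw" "D b0 fu = 1" "D b0 s \<noteq> 1"
        using lex[of fu s fw] fus fwu s E_fws fufw dist_sym[of fu fw] fu fw by auto
      have b: "D b fu = 1" "D b s \<noteq> 1"
        using LeastI[of "\<lambda>b. D b fu = 1 \<and> D b s \<noteq> 1" b0] b0 unfolding b_def by auto
      have b_min: "D j s = 1" if "j < b" "D j fu = 1" for j
        using not_less_Least that unfolding b_def by blast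
      have "b \<le> b0"
        unfolding b_def by (rule Least_le) (use b0 in auto)
      then have bfw: "b < fw" "b < N"
        using b0 fw by auto
      have b_fw: "\<not> D b fw \<le> 1"
      proof
        assume *: "D b fw \<le> 1"
        then have "D fw b = 1"
          using dist_eq_0[of b fw] dist_sym[of b fw] bfw fw by (auto simp: le_Suc_eq)
        moreover have "\<not> D b s \<le> 1"
          using b dist_eq_0[of b s] bfw fws s by (auto simp: le_Suc_eq)
        ultimately show False
          using no_induced_square[of b fu s fw] b E_fus E_fws fufw bfw s fu fw by auto
      qed
      define g where "g = (LEAST g. D g fw = 1 \<and> D g fu \<noteq> 1)"
      obtain g0 where g0: "g0 < b" "D g0 fw = 1" "D g0 fu \<noteq> 1"
        using lex[of fw fu b] fwu bfw b b_fw fu by auto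
      have g: "D g fw = 1" "D g fu \<noteq> 1"
        using LeastI[of "\<lambda>g. D g fw = 1 \<and> D g fu \<noteq> 1" g0] g0 unfolding g_def by auto
      have g_min: "D j fu = 1" if "j < g" "D j fw = 1" for j
        using not_less_Least that unfolding g_def by blast
      have "g \<le> g0"
        unfolding g_def by (rule Least_le) (use g0 in auto)
      then have gb: "g < b" "g < fw" "g < N"
        using g0 bfw by auto
      \<comment> \<open>A neighbour \<open>g\<close> of \<open>s\<close> that is not adjacent to
        \<open>fu\<close> would force a neighbour of \<open>fu\<close> before \<open>g\<close> that
        is not adjacent to \<open>s\<close>, against the minimality of \<open>b\<close>.\<close>
      have g_s: "D g s \<noteq> 1"
      proof
        assume "D g s = 1"
        then obtain m where "m < g" "D m fu = 1" "D m s \<noteq> 1"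
          using lex[of fu s g] gb fus fwu s g by auto
        then show False
          using b_min[of m] gb by auto
      qed
      have far: "\<not> D g fu \<le> 1" "\<not> D g s \<le> 1" "\<not> D g w \<le> 1" "\<not> D g u \<le> 1"
        using dist_eq_0[of g fu] dist_eq_0[of g s] dist_eq_0[of g w] dist_eq_0[of g u]
          g g_s fw_min[of g] fu_min[of g] gb fwu fws s fu fw lt by (auto simp: le_Suc_eq)
      have lg: "D 0 g \<le> k"
        using level_mono[of g fw] gb fw lfw by simp
      have "k \<noteq> 0"
        using lfu lfw dist_eq_0[of 0 fu] dist_eq_0[of 0 fw] fu fw \<open>fw \<noteq> fu\<close> by auto
      then obtain k' where k': "k = Suc k'"
        by (metis not0_implies_Suc)
      \<comment> \<open>The vertex \<open>c\<close> bounds the distance from \<open>g\<close> to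
        \<open>fu\<close> by 2. If \<open>g\<close> is on level \<open>k\<close>, take the father of
        \<open>fw\<close>, which precedes \<open>g\<close> and so is adjacent to \<open>fu\<close>
        by \<open>g_min\<close>; otherwise take the father of \<open>s\<close>, which dominates
        \<open>fu\<close> and \<open>fw\<close> by induction.\<close>
      obtain c where c: "c < N" "D 0 c = k'" "D c g = 1" "D c fu = 1"
      proof (cases "D 0 g = k")
        case True
        have "0 < fw"
          using gb by simp
        then have f: "father fw < N" "D (father fw) fw = 1" "D 0 (father fw) = k'"
          using father[of fw] level_father[of fw k'] fw lfw k' by auto
        have "D (father fw) g \<le> 1"
          using IHu[of fw g] fw gb lt g by simp
        then have "D (father fw) g = 1"
          using True f k' dist_eq_0[of "father fw" g] gb by (auto simp: le_Suc_eq)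
        moreover have "father fw < g"
          using level_mono[of g "father fw"] f True k' by (cases "g \<le> father fw") auto
        then have "D (father fw) fu = 1"
          using g_min f by simp
        ultimately show ?thesis
          using that f by blast
      next
        case False
        then have lg': "D 0 g \<le> k'"
          using lg k' by simp
        have "0 < s"
          using fws by simp
        then have f: "father s < N" "D (father s) s = 1" "D 0 (father s) = k'"
          using father[of s] level_father[of s k'] s k' by auto
        have "D (father s) fu \<le> 1" "D (father s) fw \<le> 1"
          using IHu[of s fu] IHu[of s fw] su fus fws s E_fus E_fws by auto
        then have f1: "D (father s) fu = 1" "D (father s) fw = 1"
          using dist_eq_0[of "father s" fu] dist_eq_0[of "father s" fw] f fu fw lfu lfw k'
          by (auto simp: le_Suc_eq)
        have "D (father s) g \<le> 1"
          using proj_clique[of 0 fw "father s" g k'] f f1 fw g gb lg' lfw k' by simp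
        then have "D (father s) g = 1"
          using dist_eq_0[of "father s" g] f g_s gb by (auto simp: le_Suc_eq)
        then show ?thesis
          using that f f1 by blast
      qed
      have cs: "D g c = 1" "D fu c = 1"
        using c dist_sym[of c g] dist_sym[of c fu] gb fu by auto
      \<comment> \<open>At distance 3, \<open>fu\<close> and \<open>w\<close> would both be
        projections of \<open>u\<close> seen from \<open>g\<close>, hence adjacent.\<close>
      have "D g u = 2"
      proof (rule ccontr)
        assume "D g u \<noteq> 2"
        moreover have "D g fu \<le> 2"
          using dist_triangle[of g c fu] gb c cs fu by simp
        ultimately have gu: "D g u = Suc 2" "D g fu \<le> 2"
          using dist_triangle[of g fu u] gb fu lt far by auto
        have "D g w \<le> 2"
          using dist_triangle[of g fw w] gb g fw lt by simp
        then show False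
          using proj_clique[of g u fu w 2] gu gb fu lt wu fu_w by simp
      qed
      then obtain t where t: "t < N" "D g t = 1" "D t u = 1"
        using geodesic[of g u 1] gb lt by auto
      have ts: "D t g = 1" "D u t = 1"
        using t gb lt dist_sym[of g t] dist_sym[of t u] by auto
      have "D 0 t \<le> Suc k"
        using dist_triangle[of 0 g t] t gb lg by simp
      moreover have "k \<le> D 0 t"
        using dist_triangle[of 0 t u] t lt lu by simp
      ultimately consider "D 0 t = Suc k" | "D 0 t = k"
        by linarith
      then show False
      proof cases
        case 1
        have "0 < t"
          using 1 dist_self[of 0] t by (cases t) auto
        have "father t \<le> g"
          using father_le gb t by simp
        \<comment> \<open>Fathers are monotone and \<open>father t \<le> g < fw\<close>; so the
          inner induction applies to \<open>t\<close>.\<close>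
        then have "t < w"
          using father_mono[of w t] \<open>0 < w\<close> gb t fw_def by (cases w t rule: linorder_cases) auto
        then have "D fu t \<le> 1"
          using IHw[of t] lt t fu_def by simp
        then have "D t fu = 1"
          using dist_eq_0[of fu t] dist_sym[of fu t] fu t lfu 1 by (auto simp: le_Suc_eq)
        \<comment> \<open>In the square \<open>g\<close>, \<open>t\<close>, \<open>fu\<close>,
          \<open>c\<close> the diagonal from \<open>g\<close> to \<open>fu\<close> is missing; the
          other one would join levels differing by 2.\<close>
        then have "D t c \<le> 1"
          using no_induced_square[of g t fu c] gb t fu c cs far by simp
        then show False
          using dist_triangle[of 0 c t] dist_sym[of c t] c t 1 k' by simp
      next
        case 2
        have "t \<noteq> s" "t \<noteq> fu" "t \<noteq> fw"
          using t far ts fw_u by auto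
        have t_s: "D t s = 1" "D s t = 1"
          using proj_clique[of 0 u t s k] dist_eq_0[of t s] dist_sym[of t s] lt t s lu 2 \<open>t \<noteq> s\<close>
          by (auto simp: le_Suc_eq)
        have t_fu: "D t fu = 1" "D fu t = 1"
          using proj_clique[of 0 u t fu k] dist_eq_0[of t fu] dist_sym[of t fu] lt t fu lfu lu 2 \<open>t \<noteq> fu\<close>
          by (auto simp: le_Suc_eq)
        have "D fw t \<le> 1"
          using no_induced_square[of g fw s t] gb fw s t g E_fws t_s far ts dist_sym[of g fw] by simp
        then have t_fw: "D fw t = 1" "D t fw = 1"
          using dist_eq_0[of t fw] dist_sym[of t fw] t fw \<open>t \<noteq> fw\<close> by (auto simp: le_Suc_eq)
        have "D w t \<le> 1"
          using no_induced_square[of fw w u t] fw_u t_fw fw wu lt t ts by simp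
        then have "D t w = 1"
          using dist_eq_0[of t w] dist_sym[of t w] t lt 2 lw by (auto simp: le_Suc_eq)
        then have "s < t"
          using s_min[of t] t 2 \<open>t \<noteq> s\<close> by (simp add: common_def)
        \<comment> \<open>The neighbour \<open>g\<close> of \<open>t\<close> is not one of
          \<open>s\<close>, so \<open>s\<close> has a still earlier neighbour \<open>h\<close> not
          adjacent to \<open>t\<close>. It turns out to be adjacent to \<open>fu\<close> but not to
          \<open>fw\<close>, and comparing \<open>fw\<close> with \<open>fu\<close> once more
          contradicts the minimality of \<open>g\<close>.\<close>
        then obtain h where h: "h < g" "D h s = 1" "D h t \<noteq> 1"
          using lex[of s t g] t gb fws g_s by auto
        have h_fu: "D h fu = 1"
        proof (rule ccontr)
          assume "D h fu \<noteq> 1"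
          then obtain m where "m < h" "D m fu = 1" "D m s \<noteq> 1"
            using lex[of fu s h] h gb fwu fus s by auto
          then show False
            using b_min[of m] h gb by simp
        qed
        have h_fw: "D h fw \<noteq> 1"
        proof
          assume *: "D h fw = 1"
          have "\<not> D h t \<le> 1"
            using h dist_eq_0[of h t] gb fws \<open>s < t\<close> t by (auto simp: le_Suc_eq)
          then show False
            using no_induced_square[of h fu t fw] * h_fu h gb fu t fw t_fu t_fw fufw dist_sym[of h fw]
            by simp
        qed
        then obtain m where "m < h" "D m fw = 1" "D m fu \<noteq> 1"
          using lex[of fw fu h] h_fu h gb fwu fu by auto
        then show False
          using g_min[of m] h by simp
      qed
    qed
  qed
qed

end

section \<open>Existence of lexicographic search orders\<close>

lemma lex_maximal_exists:
  assumes "U \<noteq> {}"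
  shows "\<exists>u\<in>U. \<forall>w\<in>U. \<forall>i<length xs. E (xs ! i) w \<longrightarrow> \<not> E (xs ! i) u \<longrightarrow>
    (\<exists>j<i. E (xs ! j) u \<and> \<not> E (xs ! j) w)"
  using assms
proof (induction xs arbitrary: U)
  case (Cons x xs)
  \<comment> \<open>Candidates adjacent to the first vertex of the list beat all others; if there
    are none, the first entry decides nothing.\<close>
  define U' where "U' = (if \<exists>u\<in>U. E x u then {u \<in> U. E x u} else U)"
  have "U' \<noteq> {}"
    using Cons.prems by (auto simp: U'_def)
  then obtain u where u: "u \<in> U'"
    and max: "\<And>w i. \<lbrakk>w \<in> U'; i < length xs; E (xs ! i) w; \<not> E (xs ! i) u\<rbrakk>
      \<Longrightarrow> \<exists>j<i. E (xs ! j) u \<and> \<not> E (xs ! j) w"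
    using Cons.IH by meson
  have "\<exists>j<i. E ((x # xs) ! j) u \<and> \<not> E ((x # xs) ! j) w"
    if w: "w \<in> U" and i: "i < length (x # xs)" "E ((x # xs) ! i) w" "\<not> E ((x # xs) ! i) u" for w i
  proof (cases "w \<in> U'")
    case True
    then have "E x u \<longleftrightarrow> E x w"
      using u by (auto simp: U'_def split: if_splits)
    then obtain i' where "i = Suc i'"
      using i by (cases i) auto
    then obtain j where "j < i'" "E (xs ! j) u" "\<not> E (xs ! j) w"
      using max[OF True, of i'] i by auto
    then show ?thesis
      using \<open>i = Suc i'\<close> by (intro exI[of _ "Suc j"]) auto
  next
    case False
    then have "E x u" "\<not> E x w"
      using u w by (auto simp: U'_def split: if_splits)
    then have "i \<noteq> 0"
      using i by (cases i) auto
    then show ?thesis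
      using \<open>E x u\<close> \<open>\<not> E x w\<close> by (intro exI[of _ 0]) auto
  qed
  moreover have "u \<in> U"
    using u by (auto simp: U'_def split: if_splits)
  ultimately show ?case
    by blast
qed auto

text \<open>A greedy choice works: each new vertex has the lexicographically largest vector of
  adjacencies to the vertices already listed. Comparing the vertex at \<open>i\<close> with a later
  one gives the condition used in \<open>lex_bfs\<close>.\<close>

lemma lex_bfs_order_exists:
  assumes "finite V"
  shows "\<exists>xs. distinct xs \<and> set xs = V \<and> (\<forall>i j l. i < j \<longrightarrow> j < length xs \<longrightarrow> l < i \<longrightarrow>
    E (xs ! l) (xs ! j) \<longrightarrow> \<not> E (xs ! l) (xs ! i) \<longrightarrow>
    (\<exists>m<l. E (xs ! m) (xs ! i) \<and> \<not> E (xs ! m) (xs ! j)))"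
proof -
  let ?lex = "\<lambda>xs u w. \<forall>l<length xs. E (xs ! l) w \<longrightarrow> \<not> E (xs ! l) u \<longrightarrow>
    (\<exists>m<l. E (xs ! m) u \<and> \<not> E (xs ! m) w)"
  have "\<exists>xs. distinct xs \<and> set xs \<subseteq> V \<and> length xs = n \<and>
    (\<forall>i<n. \<forall>w\<in>V - set (take i xs). ?lex (take i xs) (xs ! i) w)" if "n \<le> card V" for n
    using that
  proof (induction n)
    case (Suc n)
    then obtain xs where xs: "distinct xs" "set xs \<subseteq> V" "length xs = n"
      "\<forall>i<n. \<forall>w\<in>V - set (take i xs). ?lex (take i xs) (xs ! i) w"
      by auto
    have "V - set xs \<noteq> {}"
      using xs Suc.prems distinct_card[of xs] by auto
    then obtain u where u: "u \<in> V - set xs" "\<forall>w\<in>V - set xs. ?lex xs u w"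
      using lex_maximal_exists[of "V - set xs" xs E] by blast
    have "\<forall>w\<in>V - set (take i (xs @ [u])). ?lex (take i (xs @ [u])) ((xs @ [u]) ! i) w"
      if "i < Suc n" for i
    proof (cases "i = n")
      case True
      then show ?thesis
        using u xs by (simp add: nth_append)
    next
      case False
      then have "i < n"
        using that by simp
      then show ?thesis
        using xs by (simp add: nth_append)
    qed
    then show ?case
      using xs u by (intro exI[of _ "xs @ [u]"]) auto
  qed auto
  from this[OF order_refl] obtain xs where xs: "distinct xs" "set xs \<subseteq> V" "length xs = card V"
    "\<forall>i<card V. \<forall>w\<in>V - set (take i xs). ?lex (take i xs) (xs ! i) w"
    by blast
  have "set xs = V"
    using card_subset_eq[OF assms xs(2)] xs distinct_card[of xs] by simp
  moreover have "\<exists>m<l. E (xs ! m) (xs ! i) \<and> \<not> E (xs ! m) (xs ! j)"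
    if ij: "i < j" "j < length xs" "l < i" "E (xs ! l) (xs ! j)" "\<not> E (xs ! l) (xs ! i)" for i j l
  proof -
    have "xs ! j \<notin> set (take i xs)"
      using ij xs(1) by (auto simp: in_set_conv_nth nth_eq_iff_index_eq)
    then have "?lex (take i xs) (xs ! i) (xs ! j)"
      using xs ij \<open>set xs = V\<close> nth_mem[of j xs] by auto
    then obtain m where "m < l" "E (take i xs ! m) (xs ! i)" "\<not> E (take i xs ! m) (xs ! j)"
      using ij by (auto dest!: spec[of _ l])
    then show ?thesis
      using ij by (intro exI[of _ m]) auto
  qed
  ultimately show ?thesis
    using xs(1) by blast
qed

section \<open>Invariant cliques\<close>

context weakly_bridged
begin

text \<open>The last vertex of a search order qualifies: all its neighbours come earlier, so its
  father dominates it.\<close>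

lemma dominated_vertex_exists:
  assumes "finite V" "card V \<ge> 2"
  shows "\<exists>u\<in>V. \<exists>y\<in>V. u \<noteq> y \<and> (\<forall>z\<in>V. d z u \<le> 1 \<longrightarrow> d z y \<le> 1)"
proof -
  obtain xs where xs: "distinct xs" "set xs = V"
    and lexi: "\<forall>i j l. i < j \<longrightarrow> j < length xs \<longrightarrow> l < i \<longrightarrow> d (xs ! l) (xs ! j) = 1 \<longrightarrow>
      d (xs ! l) (xs ! i) \<noteq> 1 \<longrightarrow> (\<exists>m<l. d (xs ! m) (xs ! i) = 1 \<and> d (xs ! m) (xs ! j) \<noteq> 1)"
    using lex_bfs_order_exists[OF \<open>finite V\<close>, of "\<lambda>x y. d x y = 1"] by blast
  define N where "N = length xs"
  define D where "D i j = d (xs ! i) (xs ! j)" for i j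
  have V: "xs ! i \<in> V" if "i \<in> {..<N}" for i
    using that xs by (auto simp: N_def)
  have nth: "\<exists>i<N. xs ! i = x" if "x \<in> V" for x
    using that xs by (auto simp: N_def in_set_conv_nth)
  \<comment> \<open>The metric is transported to positions in \<open>xs\<close>, where the search
    order becomes the order of the natural numbers.\<close>
  interpret L: lex_bfs N D
  proof
    fix x y assume "x \<in> {..<N}" "y \<in> {..<N}"
    then show "D x y = 0 \<longleftrightarrow> x = y" "D x y = D y x"
      using V dist_eq_0[of "xs ! x" "xs ! y"] dist_sym[of "xs ! x" "xs ! y"] xs(1)
      by (auto simp: D_def N_def nth_eq_iff_index_eq)
  next
    fix x y z assume "x \<in> {..<N}" "y \<in> {..<N}" "z \<in> {..<N}"
    then show "D x z \<le> D x y + D y z"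
      unfolding D_def by (intro dist_triangle V)
  next
    fix x y n assume "x \<in> {..<N}" "y \<in> {..<N}" "D x y = Suc n"
    then obtain z where "z \<in> V" "d (xs ! x) z = n" "d z (xs ! y) = 1"
      using geodesic[of "xs ! x" "xs ! y" n] V by (auto simp: D_def)
    then show "\<exists>z\<in>{..<N}. D x z = n \<and> D z y = 1"
      using nth[of z] by (auto simp: D_def)
  next
    fix v x y z n
    assume "v \<in> {..<N}" "x \<in> {..<N}" "y \<in> {..<N}" "z \<in> {..<N}" "D v x = Suc n" "D v y \<le> n"
      "D v z \<le> n" "D y x = 1" "D z x = 1"
    then show "D y z \<le> 1"
      using proj_clique[of "xs ! v" "xs ! x" "xs ! y" "xs ! z" n] V by (auto simp: D_def)
  next
    fix v x y n
    assume "v \<in> {..<N}" "x \<in> {..<N}" "y \<in> {..<N}" "D v x = Suc n" "D v y = Suc n" "D x y = 1"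
    then obtain z where "z \<in> V" "d (xs ! v) z = n" "d z (xs ! x) = 1" "d z (xs ! y) = 1"
      using proj_edge[of "xs ! v" "xs ! x" "xs ! y" n] V by (auto simp: D_def)
    then show "\<exists>z\<in>{..<N}. D v z = n \<and> D z x = 1 \<and> D z y = 1"
      using nth[of z] by (auto simp: D_def)
  next
    fix i j l assume "i < j" "j < N" "l < i" "D l j = 1" "D l i \<noteq> 1"
    then show "\<exists>m<l. D m i = 1 \<and> D m j \<noteq> 1"
      using lexi by (auto simp: D_def N_def)
  qed
  have "N \<ge> 2"
    using assms xs distinct_card[of xs] by (auto simp: N_def)
  define u where "u = N - 1"
  have u: "0 < u" "u < N"
    using \<open>N \<ge> 2\<close> by (auto simp: u_def)
  note f = L.father[OF u]
  have "d z (xs ! L.father u) \<le> 1" if z: "z \<in> V" "d z (xs ! u) \<le> 1" for z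
  proof -
    obtain w where w: "w < N" "xs ! w = z"
      using nth[OF z(1)] by blast
    show ?thesis
    proof (cases "w = u")
      case False
      then have "w < u"
        using w by (auto simp: u_def)
      moreover have "D w u = 1"
        using z(2) w False L.dist_eq_0[of w u] u by (auto simp: D_def le_Suc_eq)
      ultimately have "D (L.father u) w \<le> 1"
        using L.father_dominates u by blast
      then show ?thesis
        using L.dist_sym[of w "L.father u"] f w by (simp add: D_def)
    qed (use w f in \<open>simp add: D_def\<close>)
  qed
  moreover have "xs ! u \<noteq> xs ! L.father u"
    using f u xs(1) by (auto simp: N_def nth_eq_iff_index_eq)
  ultimately show ?thesis
    using V u f by (intro bexI[of _ "xs ! u"] bexI[of _ "xs ! L.father u"]) auto
qed

text \<open>One representative of each class of vertices with the same closed neighbourhood is kept.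
  A dominated representative would also be dominated in \<open>V\<close>, hence be a twin of a
  different representative, which is impossible; so only one class exists.\<close>

lemma twins_if_undominated:
  assumes "finite V" "V \<noteq> {}"
  defines "nbr \<equiv> \<lambda>x. {y \<in> V. d y x \<le> 1}"
  assumes und: "\<And>x y. \<lbrakk>x \<in> V; y \<in> V; nbr x \<subseteq> nbr y\<rbrakk> \<Longrightarrow> nbr x = nbr y"
    and "x \<in> V" "y \<in> V"
  shows "d x y \<le> 1"
proof -
  define rep where "rep x = (SOME y. y \<in> V \<and> nbr y = nbr x)" for x
  have rep: "rep x \<in> V \<and> nbr (rep x) = nbr x" if "x \<in> V" for x
    unfolding rep_def by (rule someI[of _ x]) (use that in auto)
  have rep_cong: "rep x = rep y" if "nbr x = nbr y" for x y
    using that by (simp add: rep_def)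
  have RV: "rep ` V \<subseteq> V"
    using rep by auto
  have "weakly_bridged (rep ` V) d"
  proof (rule dominating_subset[OF RV])
    fix z assume z: "z \<in> V"
    then have "\<forall>y\<in>V. d y z \<le> 1 \<longrightarrow> d y (rep z) \<le> 1"
      using rep[OF z] by (auto simp: nbr_def)
    then show "\<exists>r\<in>rep ` V. \<forall>y\<in>V. d y z \<le> 1 \<longrightarrow> d y r \<le> 1"
      using z by blast
  qed
  then interpret R: weakly_bridged "rep ` V" d .
  have "card (rep ` V) \<le> Suc 0"
  proof (rule ccontr)
    assume "\<not> card (rep ` V) \<le> Suc 0"
    then obtain a b where ab: "a \<in> V" "b \<in> V" "rep a \<noteq> rep b"
      and dom: "\<And>z. \<lbrakk>z \<in> V; d (rep z) (rep a) \<le> 1\<rbrakk> \<Longrightarrow> d (rep z) (rep b) \<le> 1"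
      using R.dominated_vertex_exists \<open>finite V\<close> by fastforce
    \<comment> \<open>Replacing a vertex by its twin does not change its adjacency to a
      representative; this carries domination from the representatives back to
      \<open>V\<close>.\<close>
    have swap: "d (rep z) (rep c) \<le> 1 \<longleftrightarrow> d z (rep c) \<le> 1" if "z \<in> V" "c \<in> V" for z c
    proof -
      have "rep c \<in> nbr (rep z) \<longleftrightarrow> rep c \<in> nbr z"
        using rep[OF that(1)] by simp
      then show ?thesis
        using rep that dist_sym[of z "rep c"] dist_sym[of "rep z" "rep c"] by (simp add: nbr_def)
    qed
    have "nbr (rep a) \<subseteq> nbr (rep b)"
      using dom swap ab by (auto simp: nbr_def)
    then have "nbr a = nbr b"
      using und[of "rep a" "rep b"] rep ab by auto
    then show False
      using rep_cong ab by blast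
  qed
  then have "\<forall>a\<in>rep ` V. \<forall>b\<in>rep ` V. a = b"
    by (rule iffD1[OF card_le_Suc0_iff_eq[OF finite_imageI[OF \<open>finite V\<close>]]])
  then have "rep x = rep y"
    using \<open>x \<in> V\<close> \<open>y \<in> V\<close> by blast
  then have "nbr x = nbr y"
    using rep[OF \<open>x \<in> V\<close>] rep[OF \<open>y \<in> V\<close>] by simp
  moreover have "x \<in> nbr x"
    using dist_self \<open>x \<in> V\<close> by (simp add: nbr_def)
  ultimately show ?thesis
    by (auto simp: nbr_def)
qed

end

lemma image_eq_of_mem_iff:
  assumes "h ` V = V" "M \<subseteq> V" and mem: "\<And>x. x \<in> V \<Longrightarrow> h x \<in> M \<longleftrightarrow> x \<in> M"
  shows "h ` M = M"
proof
  show "h ` M \<subseteq> M"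
    using mem \<open>M \<subseteq> V\<close> by auto
  show "M \<subseteq> h ` M"
  proof
    fix y assume "y \<in> M"
    then obtain x where "x \<in> V" "y = h x"
      using assms(1,2) by fastforce
    then show "y \<in> h ` M"
      using mem \<open>y \<in> M\<close> by simp
  qed
qed

text \<open>Induction on the size of \<open>V\<close>: restrict to the vertices with maximal closed
  neighbourhood until all vertices are of this kind, and then \<open>V\<close> itself is a
  clique.\<close>

lemma invariant_clique_finite:
  assumes "weakly_bridged V d" "finite V" "V \<noteq> {}"
    and "\<And>h. h \<in> H \<Longrightarrow> h ` V = V"
    and "\<And>h x y. \<lbrakk>h \<in> H; x \<in> V; y \<in> V\<rbrakk> \<Longrightarrow> d (h x) (h y) = d x y"
  shows "\<exists>\<sigma>\<subseteq>V. \<sigma> \<noteq> {} \<and> (\<forall>x\<in>\<sigma>. \<forall>y\<in>\<sigma>. d x y \<le> 1) \<and> (\<forall>h\<in>H. h ` \<sigma> = \<sigma>)"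
  using assms
proof (induction "card V" arbitrary: V rule: less_induct)
  case less
  interpret weakly_bridged V d
    by fact
  note H = less.prems(4,5)
  define nbr where "nbr = (\<lambda>x. {y \<in> V. d y x \<le> 1})"
  define M where "M = {x \<in> V. \<forall>y\<in>V. nbr x \<subseteq> nbr y \<longrightarrow> nbr x = nbr y}"
  have above: "\<exists>m\<in>M. nbr z \<subseteq> nbr m" if z: "z \<in> V" for z
  proof -
    have "\<exists>S\<in>nbr ` V. nbr z \<subseteq> S \<and> (\<forall>T\<in>nbr ` V. S \<subseteq> T \<longrightarrow> S = T)"
      by (rule finite_has_maximal2) (use z \<open>finite V\<close> in auto)
    then show ?thesis
      by (auto simp: M_def)
  qed
  show ?case
  proof (cases "M = V")
    case True
    then have "d x y \<le> 1" if "x \<in> V" "y \<in> V" for x y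
      using twins_if_undominated[of x y] that less.prems unfolding M_def nbr_def by blast
    then show ?thesis
      using less.prems(3) H(1) by (intro exI[of _ V]) simp
  next
    case False
    have MV: "M \<subseteq> V"
      by (auto simp: M_def)
    have wM: "weakly_bridged M d"
    proof (rule dominating_subset[OF MV])
      fix z assume "z \<in> V"
      then show "\<exists>r\<in>M. \<forall>y\<in>V. d y z \<le> 1 \<longrightarrow> d y r \<le> 1"
        using above[of z] by (auto simp: nbr_def subset_iff)
    qed
    have "M \<noteq> {}"
      using above less.prems(3) by auto
    have "h ` M = M" if h: "h \<in> H" for h
    proof -
      have hV: "h ` V = V"
        using H h by blast
      have mem: "h y \<in> nbr (h x) \<longleftrightarrow> y \<in> nbr x" if "x \<in> V" "y \<in> V" for x y
        using that H(2)[OF h] hV by (auto simp: nbr_def)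
      \<comment> \<open>An isometry of \<open>V\<close> onto itself preserves inclusion of closed
        neighbourhoods, which makes \<open>M\<close> invariant.\<close>
      have sub: "nbr (h x) \<subseteq> nbr (h y) \<longleftrightarrow> nbr x \<subseteq> nbr y" if xy: "x \<in> V" "y \<in> V" for x y
      proof -
        have "nbr (h x) \<subseteq> nbr (h y) \<longleftrightarrow> (\<forall>z\<in>h ` V. z \<in> nbr (h x) \<longrightarrow> z \<in> nbr (h y))"
          unfolding hV by (auto simp: nbr_def)
        also have "\<dots> \<longleftrightarrow> (\<forall>z\<in>V. z \<in> nbr x \<longrightarrow> z \<in> nbr y)"
          using mem[OF xy(1)] mem[OF xy(2)] by simp
        also have "\<dots> \<longleftrightarrow> nbr x \<subseteq> nbr y"
          by (auto simp: nbr_def)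
        finally show ?thesis .
      qed
      have "h x \<in> M \<longleftrightarrow> x \<in> M" if x: "x \<in> V" for x
      proof -
        have "h x \<in> M \<longleftrightarrow> (\<forall>y\<in>h ` V. nbr (h x) \<subseteq> nbr y \<longrightarrow> nbr y \<subseteq> nbr (h x))"
          using x hV by (auto simp: M_def)
        also have "\<dots> \<longleftrightarrow> x \<in> M"
          using x sub by (auto simp: M_def)
        finally show ?thesis .
      qed
      then show ?thesis
        by (rule image_eq_of_mem_iff[OF hV MV])
    qed
    moreover have "card M < card V"
      using False MV \<open>finite V\<close> by (simp add: psubset_card_mono psubset_eq)
    moreover have "finite M"
      using MV \<open>finite V\<close> finite_subset by blast
    moreover have "d (h x) (h y) = d x y" if "h \<in> H" "x \<in> M" "y \<in> M" for h x y
      using H(2) MV that by (simp add: subset_iff)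
    ultimately have "\<exists>\<sigma>\<subseteq>M. \<sigma> \<noteq> {} \<and> (\<forall>x\<in>\<sigma>. \<forall>y\<in>\<sigma>. d x y \<le> 1) \<and> (\<forall>h\<in>H. h ` \<sigma> = \<sigma>)"
      by (intro less.hyps[of M] wM \<open>M \<noteq> {}\<close>)
    then show ?thesis
      by (elim ex_forward conj_forward) (use MV in auto)
  qed
qed

text \<open>A possibly infinite vertex set is reduced to a finite convex invariant piece, an
  intersection of balls of one radius around the points of \<open>B\<close>.\<close>

lemma (in weakly_bridged) invariant_clique:
  assumes B: "finite B" "B \<noteq> {}" "B \<subseteq> V" "\<And>h. h \<in> H \<Longrightarrow> h ` B = B"
    and H: "\<And>h. h \<in> H \<Longrightarrow> h ` V = V"
      "\<And>h x y. \<lbrakk>h \<in> H; x \<in> V; y \<in> V\<rbrakk> \<Longrightarrow> d (h x) (h y) = d x y"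
    and balls: "\<And>x r. x \<in> V \<Longrightarrow> finite {y \<in> V. d x y \<le> r}"
  shows "\<exists>\<sigma>\<subseteq>V. finite \<sigma> \<and> \<sigma> \<noteq> {} \<and> (\<forall>x\<in>\<sigma>. \<forall>y\<in>\<sigma>. d x y \<le> 1) \<and> (\<forall>h\<in>H. h ` \<sigma> = \<sigma>)"
proof -
  obtain v where v: "v \<in> B"
    using B by blast
  \<comment> \<open>The radius is large enough for \<open>v\<close> to lie in all the balls, so that
    \<open>C\<close> is nonempty.\<close>
  define r where "r = Max ((\<lambda>u. d u v) ` B)"
  define C where "C = {z \<in> V. \<forall>u\<in>B. d u z \<le> r}"
  have "v \<in> C"
    using v B by (auto simp: C_def r_def)
  have CV: "C \<subseteq> V"
    by (auto simp: C_def)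
  have "weakly_bridged C d"
  proof (rule convex_subset[OF CV])
    fix x y z assume *: "x \<in> C" "y \<in> C" "z \<in> V" "d x z + d z y = d x y"
    have "d u z \<le> r" if "u \<in> B" for u
      using interval_level_le[of u x y z] * that B by (force simp: C_def)
    then show "z \<in> C"
      using * by (simp add: C_def)
  qed
  moreover have "finite C"
    by (rule finite_subset[OF _ balls[of v r]]) (use v B in \<open>auto simp: C_def\<close>)
  moreover have "h ` C = C" if h: "h \<in> H" for h
  proof -
    have "h z \<in> C \<longleftrightarrow> z \<in> C" if z: "z \<in> V" for z
    proof -
      have "h z \<in> C \<longleftrightarrow> (\<forall>u\<in>h ` B. d u (h z) \<le> r)"
        using z H(1)[OF h] B(4)[OF h] by (auto simp: C_def)
      also have "\<dots> \<longleftrightarrow> (\<forall>u\<in>B. d u z \<le> r)"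
        using z H(2)[OF h _ z] B(3) by (simp add: subset_iff)
      also have "\<dots> \<longleftrightarrow> z \<in> C"
        using z by (simp add: C_def)
      finally show ?thesis .
    qed
    then show ?thesis
      by (rule image_eq_of_mem_iff[OF H(1)[OF h] CV])
  qed
  moreover have "C \<noteq> {}"
    using \<open>v \<in> C\<close> by blast
  moreover have "d (h x) (h y) = d x y" if "h \<in> H" "x \<in> C" "y \<in> C" for h x y
    using H(2) CV that by (simp add: subset_iff)
  ultimately have "\<exists>\<sigma>\<subseteq>C. \<sigma> \<noteq> {} \<and> (\<forall>x\<in>\<sigma>. \<forall>y\<in>\<sigma>. d x y \<le> 1) \<and> (\<forall>h\<in>H. h ` \<sigma> = \<sigma>)"
    by (intro invariant_clique_finite)
  then obtain \<sigma> where "\<sigma> \<subseteq> C" and \<sigma>: "\<sigma> \<noteq> {}" "\<forall>x\<in>\<sigma>. \<forall>y\<in>\<sigma>. d x y \<le> 1" "\<forall>h\<in>H. h ` \<sigma> = \<sigma>"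
    by (elim exE conjE)
  moreover from \<open>\<sigma> \<subseteq> C\<close> have "\<sigma> \<subseteq> V" "finite \<sigma>"
    using CV \<open>finite C\<close> finite_subset by auto
  ultimately show ?thesis
    by (intro exI[of _ \<sigma>] conjI)
qed

section \<open>Elementary facts on simplices\<close>

lemma simplicial_complexD:
  assumes "simplicial_complex X" "\<sigma> \<in> X"
  shows "finite \<sigma>" "\<sigma> \<noteq> {}" "\<lbrakk>\<tau> \<subseteq> \<sigma>; \<tau> \<noteq> {}\<rbrakk> \<Longrightarrow> \<tau> \<in> X"
proof -
  have "\<forall>\<sigma>\<in>X. finite \<sigma> \<and> \<sigma> \<noteq> {}" and face: "\<forall>\<sigma>\<in>X. \<forall>\<tau>. \<tau> \<subseteq> \<sigma> \<and> \<tau> \<noteq> {} \<longrightarrow> \<tau> \<in> X"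
    using assms(1) unfolding simplicial_complex_def by (rule conjunct1, rule conjunct2)
  then show "finite \<sigma>" "\<sigma> \<noteq> {}"
    using bspec[OF _ assms(2)] by auto
  show "\<tau> \<in> X" if "\<tau> \<subseteq> \<sigma>" "\<tau> \<noteq> {}"
    using bspec[OF face assms(2), THEN spec[of _ \<tau>]] that by simp
qed

lemma singleton_simplex:
  assumes "simplicial_complex X" "v \<in> vertices X"
  shows "{v} \<in> X"
proof -
  obtain \<sigma> where "\<sigma> \<in> X" "v \<in> \<sigma>"
    using assms(2) by (auto simp: vertices_def)
  then show ?thesis
    using simplicial_complexD(3)[OF assms(1), of \<sigma> "{v}"] by simp
qed

section \<open>Weakly systolic complexes\<close>

lemma relpow_sym:
  assumes "sym R" "(x, y) \<in> R ^^ n"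
  shows "(y, x) \<in> R ^^ n"
  using assms(2)
proof (induction n arbitrary: y)
  case (Suc n)
  then obtain z where "(x, z) \<in> R ^^ n" "(z, y) \<in> R"
    by auto
  then show ?case
    using Suc.IH \<open>sym R\<close> by (intro relpow_Suc_I2) (auto dest: symD)
qed auto

lemma sym_adjacency: "sym (adjacency X)"
  by (auto simp: adjacency_def sym_def insert_commute)

lemma adjacency_vertices: "(u, v) \<in> adjacency X \<Longrightarrow> u \<in> vertices X \<and> v \<in> vertices X"
  by (auto simp: adjacency_def vertices_def)

lemma graph_dist_le: "(u, v) \<in> adjacency X ^^ n \<Longrightarrow> graph_dist X u v \<le> n"
  unfolding graph_dist_def by (rule Least_le)

lemma relpow_graph_dist:
  assumes "connected_skeleton X" "u \<in> vertices X" "v \<in> vertices X"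
  shows "(u, v) \<in> adjacency X ^^ graph_dist X u v"
proof -
  have "\<exists>n. (u, v) \<in> adjacency X ^^ n"
    using assms by (simp add: connected_skeleton_def rtrancl_power)
  then show ?thesis
    unfolding graph_dist_def by (rule LeastI_ex)
qed

lemma graph_dist_eq_1:
  assumes "connected_skeleton X" "u \<in> vertices X" "v \<in> vertices X"
  shows "graph_dist X u v = 1 \<longleftrightarrow> (u, v) \<in> adjacency X"
proof
  assume "graph_dist X u v = 1"
  then show "(u, v) \<in> adjacency X"
    using relpow_graph_dist[OF assms] by simp
next
  assume *: "(u, v) \<in> adjacency X"
  then have "graph_dist X u v \<le> 1"
    using graph_dist_le[of u v 1 X] by simp
  moreover have "u \<noteq> v"
    using * by (simp add: adjacency_def)
  then have "graph_dist X u v \<noteq> 0"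
    using relpow_graph_dist[OF assms] by (intro notI) simp
  ultimately show "graph_dist X u v = 1"
    by simp
qed

text \<open>The simplex condition applied to a vertex yields \<open>proj_clique\<close>, and applied
  to an edge, by nonemptiness, \<open>proj_edge\<close>; the other properties are those of a path
  metric.\<close>

lemma weakly_bridged_skeleton:
  assumes "weakly_systolic X"
  shows "weakly_bridged (vertices X) (graph_dist X)"
proof -
  have X: "simplicial_complex X" "connected_skeleton X"
    and proj: "\<And>v i \<sigma>. \<lbrakk>v \<in> vertices X; \<sigma> \<in> X; \<sigma> \<subseteq> graph_sphere X (i + 1) v\<rbrakk> \<Longrightarrow>
      {w \<in> graph_ball X i v. \<forall>u\<in>\<sigma>. (w, u) \<in> adjacency X} \<in> X"
    using assms by (auto simp: weakly_systolic_def)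
  note path = relpow_graph_dist[OF X(2)] and adj = graph_dist_eq_1[OF X(2)]
  have tri: "graph_dist X x z \<le> graph_dist X x y + graph_dist X y z"
    if "x \<in> vertices X" "y \<in> vertices X" "z \<in> vertices X" for x y z
  proof (rule graph_dist_le)
    have "(x, z) \<in> adjacency X ^^ graph_dist X x y O adjacency X ^^ graph_dist X y z"
      using path that by blast
    then show "(x, z) \<in> adjacency X ^^ (graph_dist X x y + graph_dist X y z)"
      by (simp add: relpow_add)
  qed
  show ?thesis
  proof
    fix x y assume xy: "x \<in> vertices X" "y \<in> vertices X"
    show "graph_dist X x y = 0 \<longleftrightarrow> x = y"
      using path[OF xy] graph_dist_le[of x y 0 X] by auto
    show "graph_dist X x y = graph_dist X y x"
      using path[OF xy] path[OF xy(2,1)] relpow_sym[OF sym_adjacency]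
      by (meson antisym graph_dist_le)
  next
    fix x y z assume "x \<in> vertices X" "y \<in> vertices X" "z \<in> vertices X"
    then show "graph_dist X x z \<le> graph_dist X x y + graph_dist X y z"
      by (rule tri)
  next
    fix x y n assume xy: "x \<in> vertices X" "y \<in> vertices X" "graph_dist X x y = Suc n"
    then obtain z where z: "(x, z) \<in> adjacency X ^^ n" "(z, y) \<in> adjacency X"
      using path[of x y] by auto
    have zV: "z \<in> vertices X"
      using adjacency_vertices[OF z(2)] ..
    then have "graph_dist X z y = 1"
      using adj xy z by blast
    moreover from this have "graph_dist X x z = n"
      using graph_dist_le[OF z(1)] tri[of x z y] xy zV by simp
    ultimately show "\<exists>z\<in>vertices X. graph_dist X x z = n \<and> graph_dist X z y = 1"
      using zV by blast
  next
    fix v x y z n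
    assume V: "v \<in> vertices X" "x \<in> vertices X" "y \<in> vertices X" "z \<in> vertices X"
      and d: "graph_dist X v x = Suc n" "graph_dist X v y \<le> n" "graph_dist X v z \<le> n"
      "graph_dist X y x = 1" "graph_dist X z x = 1"
    define T where "T = {w \<in> graph_ball X n v. \<forall>u\<in>{x}. (w, u) \<in> adjacency X}"
    have "{x} \<in> X"
      by (rule singleton_simplex[OF X(1) V(2)])
    then have "T \<in> X"
      unfolding T_def using proj[of v "{x}" n] V d by (auto simp: graph_sphere_def)
    moreover have "{y, z} \<subseteq> T"
      using V d adj[of y x] adj[of z x] by (auto simp: T_def graph_ball_def)
    ultimately have "{y, z} \<in> X"
      using simplicial_complexD(3)[OF X(1)] by simp
    then have "y = z \<or> (y, z) \<in> adjacency X"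
      by (auto simp: adjacency_def)
    then show "graph_dist X y z \<le> 1"
      using graph_dist_le[of y z 0 X] graph_dist_le[of y z 1 X] by auto
  next
    fix v x y n
    assume V: "v \<in> vertices X" "x \<in> vertices X" "y \<in> vertices X"
      and d: "graph_dist X v x = Suc n" "graph_dist X v y = Suc n" "graph_dist X x y = 1"
    define T where "T = {w \<in> graph_ball X n v. \<forall>u\<in>{x, y}. (w, u) \<in> adjacency X}"
    have "(x, y) \<in> adjacency X"
      using adj V d by blast
    then have "{x, y} \<in> X"
      by (simp add: adjacency_def)
    then have "T \<in> X"
      unfolding T_def using proj[of v "{x, y}" n] V d by (auto simp: graph_sphere_def)
    then obtain z where z: "z \<in> T"
      using simplicial_complexD(2)[OF X(1)] by fastforce
    then have zV: "z \<in> vertices X" "graph_dist X v z \<le> n"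
      and zd: "graph_dist X z x = 1" "graph_dist X z y = 1"
      using adj V by (auto simp: T_def graph_ball_def)
    moreover from this have "graph_dist X v z = n"
      using tri[of v z x] d V by simp
    ultimately show "\<exists>z\<in>vertices X. graph_dist X v z = n \<and> graph_dist X z x = 1 \<and> graph_dist X z y = 1"
      by blast
  qed
qed

text \<open>The next larger ball is covered by the previous one together with the stars of its
  vertices, each a finite union of finite simplices.\<close>

lemma finite_graph_ball:
  assumes X: "weakly_systolic X" "locally_finite_complex X" and "x \<in> vertices X"
  shows "finite {y \<in> vertices X. graph_dist X x y \<le> r}"
proof (induction r)
  interpret weakly_bridged "vertices X" "graph_dist X"
    by (rule weakly_bridged_skeleton[OF X(1)])
  have sc: "simplicial_complex X" "connected_skeleton X"
    using X(1) by (auto simp: weakly_systolic_def)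
  {
    case 0
    have "{y \<in> vertices X. graph_dist X x y \<le> 0} \<subseteq> {x}"
      using dist_eq_0 \<open>x \<in> vertices X\<close> by auto
    then show ?case
      using finite_subset by blast
  next
    case (Suc r)
    let ?B = "{y \<in> vertices X. graph_dist X x y \<le> r}"
    have "{y \<in> vertices X. graph_dist X x y \<le> Suc r} \<subseteq> ?B \<union> (\<Union>z\<in>?B. \<Union>{\<sigma> \<in> X. z \<in> \<sigma>})"
    proof
      fix y assume y: "y \<in> {y \<in> vertices X. graph_dist X x y \<le> Suc r}"
      show "y \<in> ?B \<union> (\<Union>z\<in>?B. \<Union>{\<sigma> \<in> X. z \<in> \<sigma>})"
      proof (cases "graph_dist X x y \<le> r")
        case False
        then have "graph_dist X x y = Suc r"
          using y by simp
        then obtain z where z: "z \<in> vertices X" "graph_dist X x z = r" "graph_dist X z y = 1"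
          using geodesic[of x y r] y \<open>x \<in> vertices X\<close> by blast
        then have "{z, y} \<in> X"
          using graph_dist_eq_1[OF sc(2), of z y] y by (simp add: adjacency_def)
        then have "y \<in> \<Union>{\<sigma> \<in> X. z \<in> \<sigma>}"
          by blast
        then show ?thesis
          using z by blast
      qed (use y in simp)
    qed
    moreover have "finite (\<Union>{\<sigma> \<in> X. z \<in> \<sigma>})" if "z \<in> ?B" for z
      using that X(2) simplicial_complexD(1)[OF sc(1)] by (auto simp: locally_finite_complex_def)
    ultimately show ?case
      using Suc.IH by (meson finite_UN finite_UnI finite_subset)
  }
qed

text \<open>Flagness yields a simplex containing \<open>A\<close>, and \<open>A\<close> is a face of
  it; in particular \<open>A\<close> is finite.\<close>

lemma clique_is_simplex:
  assumes X: "weakly_systolic X" and A: "A \<subseteq> vertices X" "A \<noteq> {}"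
    and clique: "\<And>u v. \<lbrakk>u \<in> A; v \<in> A\<rbrakk> \<Longrightarrow> graph_dist X u v \<le> 1"
  shows "A \<in> X"
proof -
  interpret weakly_bridged "vertices X" "graph_dist X"
    by (rule weakly_bridged_skeleton[OF X])
  have sc: "simplicial_complex X" "connected_skeleton X" "flag X"
    using X by (auto simp: weakly_systolic_def)
  have "\<exists>\<sigma>\<in>X. u \<in> \<sigma> \<and> v \<in> \<sigma>" if uv: "u \<in> A" "v \<in> A" for u v
  proof (cases "u = v")
    case True
    then show ?thesis
      using uv A by (auto simp: vertices_def)
  next
    case False
    have V: "u \<in> vertices X" "v \<in> vertices X"
      using uv A(1) by auto
    then have "graph_dist X u v = 1"
      using clique[OF uv] dist_eq_0[OF V] False by simp
    then have "{u, v} \<in> X"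
      using graph_dist_eq_1[OF sc(2) V] by (simp add: adjacency_def)
    then show ?thesis
      by blast
  qed
  then obtain \<sigma> where "\<sigma> \<in> X" "A \<subseteq> \<sigma>"
    using sc(3) A(1) unfolding flag_def by metis
  then show ?thesis
    using simplicial_complexD(3)[OF sc(1)] A(2) by blast
qed

section \<open>Isometric actions and invariant simplices\<close>

lemma graph_dist_action_le:
  assumes act: "simplicial_action G X \<phi>" and conn: "connected_skeleton X"
    and g: "g \<in> carrier G" and uv: "u \<in> vertices X" "v \<in> vertices X"
  shows "graph_dist X (\<phi> g u) (\<phi> g v) \<le> graph_dist X u v"
proof -
  interpret group_action G "vertices X" \<phi>
    using act by (simp add: simplicial_action_def)
  have adj: "(\<phi> g x, \<phi> g y) \<in> adjacency X" if xy: "(x, y) \<in> adjacency X" for x y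
  proof -
    have "{x, y} \<in> X"
      using xy by (simp add: adjacency_def)
    then have "\<phi> g ` {x, y} \<in> X"
      using act g unfolding simplicial_action_def by blast
    moreover have "\<phi> g x \<noteq> \<phi> g y"
      using inj_prop[OF g] adjacency_vertices[OF xy] xy by (auto simp: adjacency_def inj_on_def)
    ultimately show ?thesis
      by (simp add: adjacency_def)
  qed
  have path: "(\<phi> g x, \<phi> g y) \<in> adjacency X ^^ n" if "(x, y) \<in> adjacency X ^^ n" for x y n
    using that
  proof (induction n arbitrary: y)
    case (Suc n)
    then show ?case
      using adj by fastforce
  qed auto
  show ?thesis
    by (rule graph_dist_le[OF path[OF relpow_graph_dist[OF conn uv]]])
qed

lemma graph_dist_action:
  assumes act: "simplicial_action G X \<phi>" and conn: "connected_skeleton X"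
    and g: "g \<in> carrier G" and uv: "u \<in> vertices X" "v \<in> vertices X"
  shows "graph_dist X (\<phi> g u) (\<phi> g v) = graph_dist X u v"
proof (rule antisym)
  interpret group_action G "vertices X" \<phi>
    using act by (simp add: simplicial_action_def)
  interpret group G
    using group_hom group_hom.axioms(1) by auto
  show "graph_dist X (\<phi> g u) (\<phi> g v) \<le> graph_dist X u v"
    by (rule graph_dist_action_le[OF act conn g uv])
  have "\<phi> g u \<in> vertices X" "\<phi> g v \<in> vertices X"
    using element_image[OF g] uv by auto
  then have "graph_dist X (\<phi> (inv\<^bsub>G\<^esub> g) (\<phi> g u)) (\<phi> (inv\<^bsub>G\<^esub> g) (\<phi> g v)) \<le> graph_dist X (\<phi> g u) (\<phi> g v)"
    using graph_dist_action_le[OF act conn] g by simp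
  then show "graph_dist X u v \<le> graph_dist X (\<phi> g u) (\<phi> g v)"
    using orbit_sym_aux[OF g] uv by simp
qed

text \<open>The invariant clique comes from the finite \<open>H\<close>-orbit of an arbitrary
  vertex; by flagness it is a simplex.\<close>

lemma finite_subgroup_stabilizes_simplex:
  assumes X: "weakly_systolic X" "locally_finite_complex X" and act: "simplicial_action G X \<phi>"
    and H: "subgroup H G" "finite H"
  shows "\<exists>\<sigma>\<in>X. \<forall>h\<in>H. \<phi> h ` \<sigma> = \<sigma>"
proof -
  interpret weakly_bridged "vertices X" "graph_dist X"
    by (rule weakly_bridged_skeleton[OF X(1)])
  interpret group_action G "vertices X" \<phi>
    using act by (simp add: simplicial_action_def)
  interpret G: group G
    using group_hom group_hom.axioms(1) by auto
  interpret H: subgroup H G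
    by (rule H(1))
  have sc: "simplicial_complex X" "connected_skeleton X" "X \<noteq> {}"
    using X(1) by (auto simp: weakly_systolic_def)
  then obtain \<sigma> where "\<sigma> \<in> X"
    by blast
  then have "\<sigma> \<noteq> {}" "\<sigma> \<subseteq> vertices X"
    using simplicial_complexD(2)[OF sc(1)] by (auto simp: vertices_def)
  then obtain v where v: "v \<in> vertices X"
    by blast
  define B where "B = (\<lambda>h. \<phi> h v) ` H"
  have BV: "B \<subseteq> vertices X"
    using element_image v H.subset by (auto simp: B_def)
  have "\<phi> h ` B = B" if h: "h \<in> H" for h
  proof
    have mult: "\<phi> h (\<phi> k v) = \<phi> (h \<otimes>\<^bsub>G\<^esub> k) v" if "k \<in> H" for k
      using composition_rule[OF v] h that by simp
    then show "\<phi> h ` B \<subseteq> B"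
      using h by (auto simp: B_def)
    show "B \<subseteq> \<phi> h ` B"
    proof
      fix y assume "y \<in> B"
      then obtain k where k: "k \<in> H" "y = \<phi> k v"
        by (auto simp: B_def)
      then have "y = \<phi> h (\<phi> (inv\<^bsub>G\<^esub> h \<otimes>\<^bsub>G\<^esub> k) v)"
        using mult[of "inv\<^bsub>G\<^esub> h \<otimes>\<^bsub>G\<^esub> k"] h by (simp add: G.m_assoc[symmetric])
      then show "y \<in> \<phi> h ` B"
        using h k by (auto simp: B_def)
    qed
  qed
  then have B_inv: "h ` B = B" if "h \<in> \<phi> ` H" for h
    using that by auto
  have B: "finite B" "B \<noteq> {}"
    unfolding B_def using H(2) H.one_closed by blast+
  have V_inv: "h ` vertices X = vertices X" if "h \<in> \<phi> ` H" for h
    using that surj_prop H.subset by blast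
  have isometry: "graph_dist X (h x) (h y) = graph_dist X x y"
    if "h \<in> \<phi> ` H" "x \<in> vertices X" "y \<in> vertices X" for h x y
    using that graph_dist_action[OF act sc(2)] H.subset by auto
  have "\<exists>\<sigma>\<subseteq>vertices X. finite \<sigma> \<and> \<sigma> \<noteq> {} \<and>
      (\<forall>x\<in>\<sigma>. \<forall>y\<in>\<sigma>. graph_dist X x y \<le> 1) \<and> (\<forall>h\<in>\<phi> ` H. h ` \<sigma> = \<sigma>)"
    by (rule invariant_clique[OF B BV B_inv V_inv isometry finite_graph_ball[OF X]])
  then obtain \<sigma> where "\<sigma> \<subseteq> vertices X" "\<sigma> \<noteq> {}" "\<forall>x\<in>\<sigma>. \<forall>y\<in>\<sigma>. graph_dist X x y \<le> 1"
    and inv: "\<forall>h\<in>\<phi> ` H. h ` \<sigma> = \<sigma>"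
    by (elim exE conjE)
  then have "\<sigma> \<in> X"
    using clique_is_simplex[OF X(1)] by blast
  then show ?thesis
    using inv by (intro bexI[of _ \<sigma>]) simp
qed

section \<open>Cocompactness and orbits of vertices\<close>

lemma open_coordinate_nonzero: "open {x :: 'v \<Rightarrow> real. x w \<noteq> 0}"
proof -
  have "open ((\<lambda>x :: 'v \<Rightarrow> real. x w) -` (- {0}))"
    by (intro open_vimage) auto
  then show ?thesis
    by (simp add: vimage_def)
qed

text \<open>Compactness is applied to the images of the sets \<open>U v\<close>; a vertex, seen as a
  point of the realization, lies in \<open>U v\<close> only if it belongs to the orbit of
  \<open>v\<close>.\<close>

lemma cocompact_finite_vertex_orbits:
  fixes X :: "'v set set"
  assumes X: "simplicial_complex X" and act: "simplicial_action G X \<phi>" and "cocompact G X \<phi>"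
  shows "\<exists>F\<subseteq>vertices X. finite F \<and> (\<forall>w\<in>vertices X. \<exists>v\<in>F. \<exists>g\<in>carrier G. w = \<phi> g v)"
proof -
  interpret group_action G "vertices X" \<phi>
    using act by (simp add: simplicial_action_def)
  interpret G: group G
    using group_hom group_hom.axioms(1) by auto
  let ?a = "realization_action G X \<phi>"
  \<comment> \<open>\<open>U v\<close> is the union of the open stars of all vertices in the orbit
    of \<open>v\<close>.\<close>
  define U where "U v = {x \<in> realization X. \<exists>g\<in>carrier G. x (\<phi> g v) \<noteq> 0}" for v
  have one: "\<phi> \<one>\<^bsub>G\<^esub> v = v" if "v \<in> vertices X" for v
    using id_eq_one that by (metis restrict_apply')
  have supp: "v \<in> vertices X" if "x \<in> realization X" "x v \<noteq> 0" for x v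
    using that by (auto simp: realization_def vertices_def)
  have "?a \<one>\<^bsub>G\<^esub> x = x" if "x \<in> realization X" for x
    using supp[OF that] one by (fastforce simp: realization_action_def)
  then have orbit_self: "x \<in> orbit G ?a x" if "x \<in> realization X" for x
    using that unfolding orbit_def by force
  \<comment> \<open>\<open>U v\<close> is a union of orbits, so it is the full preimage of its
    image, and that image is open in the quotient.\<close>
  have saturated: "x \<in> U v"
    if x: "x \<in> realization X" and v: "v \<in> vertices X" and xU: "orbit G ?a x \<in> orbit G ?a ` U v" for x v
  proof -
    obtain y where y: "y \<in> U v" "orbit G ?a x = orbit G ?a y"
      using xU by blast
    then have "x \<in> orbit G ?a y"
      using orbit_self[OF x] by simp
    then obtain g where g: "g \<in> carrier G" "x = ?a g y"
      by (auto simp: orbit_def)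
    obtain h where h: "h \<in> carrier G" "y (\<phi> h v) \<noteq> 0"
      using y by (auto simp: U_def)
    have "x (\<phi> g (\<phi> h v)) = y (\<phi> h v)"
      unfolding g(2) using element_image[OF h(1) v] g(1)
      by (intro realization_action_apply) (auto simp: group_action_axioms)
    then have "x (\<phi> (g \<otimes>\<^bsub>G\<^esub> h) v) \<noteq> 0"
      using composition_rule[OF v g(1) h(1)] h by simp
    then show ?thesis
      using x g h by (auto simp: U_def)
  qed
  have "openin (realization_topology X) (U v)" for v
    unfolding openin_realization_topology
  proof (intro conjI ballI)
    show "U v \<subseteq> realization X"
      by (auto simp: U_def)
    fix \<sigma> assume "\<sigma> \<in> X"
    have "open (\<Union>g\<in>carrier G. {x :: 'v \<Rightarrow> real. x (\<phi> g v) \<noteq> 0})"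
      by (intro open_UN ballI open_coordinate_nonzero)
    moreover have "U v \<inter> closed_face X \<sigma> =
        closed_face X \<sigma> \<inter> (\<Union>g\<in>carrier G. {x. x (\<phi> g v) \<noteq> 0})"
      by (auto simp: U_def closed_face_def)
    ultimately show "openin (top_of_set (closed_face X \<sigma>)) (U v \<inter> closed_face X \<sigma>)"
      unfolding openin_open by blast
  qed
  moreover have "{x \<in> realization X. orbit G ?a x \<in> orbit G ?a ` U v} = U v"
    if "v \<in> vertices X" for v
    using saturated[OF _ that] by (auto simp: U_def)
  moreover have "orbit G ?a ` U v \<subseteq> orbits G (realization X) ?a" for v
    by (auto simp: U_def orbits_def)
  ultimately have "\<forall>W\<in>(\<lambda>v. orbit G ?a ` U v) ` vertices X. openin (orbit_space G X \<phi>) W"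
    unfolding openin_orbit_space by simp
  moreover have "topspace (orbit_space G X \<phi>) \<subseteq> \<Union>((\<lambda>v. orbit G ?a ` U v) ` vertices X)"
  proof
    fix c assume "c \<in> topspace (orbit_space G X \<phi>)"
    then obtain x where x: "x \<in> realization X" "c = orbit G ?a x"
      by (auto simp: topspace_orbit_space orbits_def)
    then have "{v. x v \<noteq> 0} \<noteq> {}"
      using simplicial_complexD(2)[OF X, of "{v. x v \<noteq> 0}"] by (simp add: realization_def)
    then obtain v where v: "x v \<noteq> 0"
      by blast
    then have "v \<in> vertices X"
      using supp x by blast
    moreover have "x \<in> U v"
      using x v one[OF \<open>v \<in> vertices X\<close>] by (auto simp: U_def intro!: bexI[of _ "\<one>\<^bsub>G\<^esub>"])
    ultimately show "c \<in> \<Union>((\<lambda>v. orbit G ?a ` U v) ` vertices X)"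
      using x by blast
  qed
  ultimately obtain \<F> where \<F>: "finite \<F>" "\<F> \<subseteq> (\<lambda>v. orbit G ?a ` U v) ` vertices X"
    "topspace (orbit_space G X \<phi>) \<subseteq> \<Union>\<F>"
    using \<open>cocompact G X \<phi>\<close> unfolding cocompact_def compact_space_alt by meson
  obtain F where F: "F \<subseteq> vertices X" "finite F" "\<F> = (\<lambda>v. orbit G ?a ` U v) ` F"
    using finite_subset_image[OF \<F>(1,2)] by (elim exE conjE)
  have "\<exists>v\<in>F. \<exists>g\<in>carrier G. w = \<phi> g v" if w: "w \<in> vertices X" for w
  proof -
    define x :: "'v \<Rightarrow> real" where "x = (\<lambda>v. if v = w then 1 else 0)"
    have "{v. x v \<noteq> 0} = {w}"
      by (auto simp: x_def)
    moreover have "{w} \<in> X"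
      by (rule singleton_simplex[OF X w])
    ultimately have x: "x \<in> realization X"
      by (simp add: realization_def x_def)
    then have "orbit G ?a x \<in> topspace (orbit_space G X \<phi>)"
      by (auto simp: topspace_orbit_space orbits_def)
    then obtain v where v: "v \<in> F" "orbit G ?a x \<in> orbit G ?a ` U v"
      using \<F>(3) F(3) by blast
    then have "x \<in> U v"
      using saturated x F(1) by blast
    then show ?thesis
      using v by (auto simp: U_def x_def split: if_splits)
  qed
  then show ?thesis
    using F by blast
qed

section \<open>Conjugation and the finiteness of the set of classes\<close>

lemma (in group) orbit_conjugate:
  assumes "H \<subseteq> carrier G" "g \<in> carrier G"
  shows "orbit G (\<lambda>g H. g <#\<^bsub>G\<^esub> H #>\<^bsub>G\<^esub> inv\<^bsub>G\<^esub> g) (g <#\<^bsub>G\<^esub> H #>\<^bsub>G\<^esub> inv\<^bsub>G\<^esub> g) = orbit G (\<lambda>g H. g <#\<^bsub>G\<^esub> H #>\<^bsub>G\<^esub> inv\<^bsub>G\<^esub> g) H"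
proof -
  let ?c = "\<lambda>g H. g <#\<^bsub>G\<^esub> H #>\<^bsub>G\<^esub> inv\<^bsub>G\<^esub> g"
  interpret P: group_action G "{H. H \<subseteq> carrier G}" "\<lambda>g. \<lambda>H\<in>{H. H \<subseteq> carrier G}. ?c g H"
    by (rule action_by_conjugation_on_power_set)
  have sub: "?c g H \<subseteq> carrier G"
    using P.element_image[OF assms(2), of H] assms by simp
  have mult: "?c a (?c g H) = ?c (a \<otimes>\<^bsub>G\<^esub> g) H" if "a \<in> carrier G" for a
    using P.composition_rule[of H a g] assms that sub by simp
  show ?thesis
  proof
    show "orbit G ?c (?c g H) \<subseteq> orbit G ?c H"
      using mult assms unfolding orbit_def by force
    show "orbit G ?c H \<subseteq> orbit G ?c (?c g H)"
    proof
      fix K assume "K \<in> orbit G ?c H"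
      then obtain a where a: "a \<in> carrier G" "K = ?c a H"
        by (auto simp: orbit_def)
      then have "K = ?c (a \<otimes>\<^bsub>G\<^esub> inv\<^bsub>G\<^esub> g) (?c g H)"
        using mult[of "a \<otimes>\<^bsub>G\<^esub> inv\<^bsub>G\<^esub> g"] assms by (simp add: m_assoc)
      then show "K \<in> orbit G ?c (?c g H)"
        using a assms unfolding orbit_def by blast
    qed
  qed
qed

theorem corollary5p4:
  fixes G :: "('g, 'b) monoid_scheme"
    and X :: "'v set set"
    and \<phi> :: "'g \<Rightarrow> 'v \<Rightarrow> 'v"
  assumes "weakly_systolic X"
    and "geometric_action G X \<phi>"
  shows "finite (finite_subgroup_classes G)"
proof -
  have act: "simplicial_action G X \<phi>" and lf: "locally_finite_complex X"
    and pd: "properly_discontinuous G X \<phi>" and cc: "cocompact G X \<phi>"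
    using assms(2) by (auto simp: geometric_action_def)
  have sc: "simplicial_complex X"
    using assms(1) by (simp add: weakly_systolic_def)
  interpret group_action G "vertices X" \<phi>
    using act by (simp add: simplicial_action_def)
  interpret G: group G
    using group_hom group_hom.axioms(1) by auto
  let ?c = "\<lambda>g H. g <#\<^bsub>G\<^esub> H #>\<^bsub>G\<^esub> inv\<^bsub>G\<^esub> g"
  let ?stab = "stabilizer G (\<lambda>g \<tau>. \<phi> g ` \<tau>)"
  obtain F where F: "F \<subseteq> vertices X" "finite F"
    "\<forall>w\<in>vertices X. \<exists>v\<in>F. \<exists>g\<in>carrier G. w = \<phi> g v"
    using cocompact_finite_vertex_orbits[OF sc act cc] by blast
  define S where "S = (\<Union>v\<in>F. {\<sigma> \<in> X. v \<in> \<sigma>})"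
  have "finite S"
    using F lf by (auto simp: S_def locally_finite_complex_def)
  \<comment> \<open>All subsets of the stabilizers are collected, so that finiteness is immediate; a
    conjugate of every finite subgroup is found among them.\<close>
  define K where "K = (\<Union>\<sigma>\<in>S. Pow (?stab \<sigma>))"
  have "finite K"
    unfolding K_def
  proof (intro finite_UN_I \<open>finite S\<close>)
    fix \<sigma> assume "\<sigma> \<in> S"
    then show "finite (Pow (?stab \<sigma>))"
      using pd by (auto simp: S_def properly_discontinuous_def)
  qed
  have "finite_subgroup_classes G \<subseteq> orbit G ?c ` K"
  proof
    fix c assume "c \<in> finite_subgroup_classes G"
    then obtain H where H: "subgroup H G" "finite H" "c = orbit G ?c H"
      by (auto simp: finite_subgroup_classes_def orbits_def)
    have HG: "H \<subseteq> carrier G"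
      using H(1) by (rule subgroup.subset)
    obtain \<sigma> where \<sigma>: "\<sigma> \<in> X" "\<forall>h\<in>H. \<phi> h ` \<sigma> = \<sigma>"
      using finite_subgroup_stabilizes_simplex[OF assms(1) lf act H(1,2)] by (elim bexE)
    have \<sigma>V: "\<sigma> \<subseteq> vertices X"
      using \<sigma>(1) by (auto simp: vertices_def)
    obtain w where w: "w \<in> \<sigma>"
      using simplicial_complexD(2)[OF sc \<sigma>(1)] by fastforce
    then obtain v g where v: "v \<in> F" and g: "g \<in> carrier G" "w = \<phi> g v"
      using F(3) \<sigma>V by blast
    \<comment> \<open>Moving \<open>\<sigma>\<close> by the inverse of \<open>g\<close> brings its
      vertex \<open>w\<close> to \<open>v\<close> in \<open>F\<close>, so the result is one of the
      finitely many simplices in \<open>S\<close>.\<close>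
    define \<tau> where "\<tau> = \<phi> (inv\<^bsub>G\<^esub> g) ` \<sigma>"
    have "v = \<phi> (inv\<^bsub>G\<^esub> g) w"
      using orbit_sym_aux[OF g(1), of v w] v F(1) g(2) by auto
    then have "v \<in> \<tau>"
      using w by (simp add: \<tau>_def)
    moreover have "\<tau> \<in> X"
      using act g \<sigma>(1) by (simp add: \<tau>_def simplicial_action_def)
    ultimately have "\<tau> \<in> S"
      using v by (auto simp: S_def)
    \<comment> \<open>Conjugating \<open>H\<close> by the inverse of \<open>g\<close> matches moving
      the simplex, so the conjugate leaves \<open>\<tau>\<close> invariant.\<close>
    have "?c (inv\<^bsub>G\<^esub> g) H \<subseteq> ?stab \<tau>"
    proof
      fix k assume "k \<in> ?c (inv\<^bsub>G\<^esub> g) H"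
      then obtain h where h: "h \<in> H" "k = inv\<^bsub>G\<^esub> g \<otimes>\<^bsub>G\<^esub> h \<otimes>\<^bsub>G\<^esub> g"
        using g by (auto simp: l_coset_def r_coset_def)
      have hG: "h \<in> carrier G"
        using h HG by blast
      have "\<phi> k (\<phi> (inv\<^bsub>G\<^esub> g) x) = \<phi> (inv\<^bsub>G\<^esub> g) (\<phi> h x)" if "x \<in> \<sigma>" for x
      proof -
        have x: "x \<in> vertices X"
          using that \<sigma>V by blast
        have "k \<otimes>\<^bsub>G\<^esub> inv\<^bsub>G\<^esub> g = inv\<^bsub>G\<^esub> g \<otimes>\<^bsub>G\<^esub> h"
          using h(2) hG g(1) by (simp add: G.m_assoc)
        then show ?thesis
          using composition_rule[OF x, of k "inv\<^bsub>G\<^esub> g"] composition_rule[OF x, of "inv\<^bsub>G\<^esub> g" h]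
            h(2) hG g(1) by simp
      qed
      then have "\<phi> k ` \<tau> = \<phi> (inv\<^bsub>G\<^esub> g) ` (\<phi> h ` \<sigma>)"
        by (simp add: \<tau>_def image_image)
      then have "\<phi> k ` \<tau> = \<tau>"
        using \<sigma>(2) h(1) by (simp add: \<tau>_def)
      then show "k \<in> ?stab \<tau>"
        using h(2) hG g(1) by (simp add: stabilizer_def)
    qed
    then have "?c (inv\<^bsub>G\<^esub> g) H \<in> K"
      using \<open>\<tau> \<in> S\<close> by (auto simp: K_def)
    moreover have "c = orbit G ?c (?c (inv\<^bsub>G\<^esub> g) H)"
      using G.orbit_conjugate[OF HG, of "inv\<^bsub>G\<^esub> g"] g(1) H(3) by simp
    ultimately show "c \<in> orbit G ?c ` K"
      by (rule image_eqI[rotated])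
  qed
  then show ?thesis
    using \<open>finite K\<close> finite_surj by blast
qed

end
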